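(* Let $R$ be a $1$-dimensional integral domain. Let $R\to S$ be a faithfully flat ring homomorphism, where $S$ is a Noetherian integral domain. Assume that for each maximal ideal $\mathfrak m$ of $R$, the map $R_{\mathfrak m}\to S_{\mathfrak m}$ is Ohm-Rush (where in both cases one inverts the multiplicative set $R\setminus\mathfrak m$). Then $R\to S$ is Ohm-Rush.
   Context: All rings are commutative with identity; dimension means Krull dimension. For a ring $R$, an $R$-module $M$ and $f\in M$, the (Ohm-Rush) content of $f$ is the ideal $c(f):=\bigcap\{I\subseteq R \text{ ideal} \mid f\in IM\}$. A ring homomorphism $R\to S$ is Ohm-Rush if $f\in c(f)S$ for all $f\in S$ (viewing $S$ as an $R$-module). *)

theory Defs
  imports
    "HOL-Algebra.Algebra"
    "HOL-Library.Extended_Nat"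
begin

text \<open>The supremum of the lengths of strict chains of prime ideals. Since \<^typ>\<open>enat\<close> has no
  negative elements, the zero ring gets dimension 0.\<close>

definition krull_dim :: "('a, 'm) ring_scheme \<Rightarrow> enat" where
  "krull_dim R =
     Sup {enat n | n. \<exists>P. (\<forall>i\<le>n. primeideal (P i) R) \<and> (\<forall>i<n. P i \<subset> P (Suc i))}"

definition module_of_hom :: "('b, 'n) ring_scheme \<Rightarrow> ('a \<Rightarrow> 'b) \<Rightarrow> ('a, 'b) module" where
  "module_of_hom S \<phi> =
     \<lparr>carrier = carrier S, monoid.mult = (\<otimes>\<^bsub>S\<^esub>), one = \<one>\<^bsub>S\<^esub>, ring.zero = \<zero>\<^bsub>S\<^esub>, ring.add = (\<oplus>\<^bsub>S\<^esub>),
      smult = (\<lambda>r s. \<phi> r \<otimes>\<^bsub>S\<^esub> s)\<rparr>"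

definition ideal_smult :: "'a set \<Rightarrow> ('a, 'b, 'm) module_scheme \<Rightarrow> 'b set" where
  "ideal_smult I M =
     {finsum M (\<lambda>k. a k \<odot>\<^bsub>M\<^esub> x k) {..<n} | (n::nat) a x.
        a \<in> {..<n} \<rightarrow> I \<and> x \<in> {..<n} \<rightarrow> carrier M}"

definition ohm_rush_content ::
    "('a, 'm) ring_scheme \<Rightarrow> ('a, 'b, 'n) module_scheme \<Rightarrow> 'b \<Rightarrow> 'a set" where
  "ohm_rush_content R M f = \<Inter> {I. ideal I R \<and> f \<in> ideal_smult I M}"

definition ohm_rush ::
    "('a, 'm) ring_scheme \<Rightarrow> ('b, 'n) ring_scheme \<Rightarrow> ('a \<Rightarrow> 'b) \<Rightarrow> bool" where
  "ohm_rush R S \<phi> \<longleftrightarrow>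
     (\<forall>f \<in> carrier S.
        f \<in> ideal_smult (ohm_rush_content R (module_of_hom S \<phi>) f) (module_of_hom S \<phi>))"

definition loc_rel :: "('a, 'm) ring_scheme \<Rightarrow> 'a set \<Rightarrow> (('a \<times> 'a) \<times> ('a \<times> 'a)) set" where
  "loc_rel R W =
     {((a, s), (b, t)) | a s b t.
        a \<in> carrier R \<and> b \<in> carrier R \<and> s \<in> W \<and> t \<in> W \<and>
        (\<exists>w\<in>W. w \<otimes>\<^bsub>R\<^esub> (a \<otimes>\<^bsub>R\<^esub> t \<ominus>\<^bsub>R\<^esub> b \<otimes>\<^bsub>R\<^esub> s) = \<zero>\<^bsub>R\<^esub>)}"

definition loc_frac :: "('a, 'm) ring_scheme \<Rightarrow> 'a set \<Rightarrow> 'a \<Rightarrow> 'a \<Rightarrow> ('a \<times> 'a) set" where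
  "loc_frac R W a s = loc_rel R W `` {(a, s)}"

text \<open>For well-defined operations, \<open>W\<close> has to be a multiplicatively closed subset of the
  carrier. A function on fractions is defined by the union of its values on all
  representatives; these values coincide.\<close>

definition localization :: "('a, 'm) ring_scheme \<Rightarrow> 'a set \<Rightarrow> ('a \<times> 'a) set ring" where
  "localization R W =
     \<lparr>carrier = (carrier R \<times> W) // loc_rel R W,
      monoid.mult = (\<lambda>A B. \<Union>(a, s)\<in>A. \<Union>(b, t)\<in>B. loc_frac R W (a \<otimes>\<^bsub>R\<^esub> b) (s \<otimes>\<^bsub>R\<^esub> t)),
      one = loc_frac R W \<one>\<^bsub>R\<^esub> \<one>\<^bsub>R\<^esub>,
      ring.zero = loc_frac R W \<zero>\<^bsub>R\<^esub> \<one>\<^bsub>R\<^esub>,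
      ring.add = (\<lambda>A B. \<Union>(a, s)\<in>A. \<Union>(b, t)\<in>B.
               loc_frac R W (a \<otimes>\<^bsub>R\<^esub> t \<oplus>\<^bsub>R\<^esub> b \<otimes>\<^bsub>R\<^esub> s) (s \<otimes>\<^bsub>R\<^esub> t))\<rparr>"

text \<open>The homomorphism from the localization of \<open>R\<close> at \<open>W\<close> to that of \<open>S\<close> at
  \<open>\<phi> ` W\<close> induced by \<open>\<phi>\<close>.\<close>

definition loc_map :: "('b, 'n) ring_scheme \<Rightarrow> 'a set \<Rightarrow> ('a \<Rightarrow> 'b) \<Rightarrow>
    ('a \<times> 'a) set \<Rightarrow> ('b \<times> 'b) set" where
  "loc_map S W \<phi> A = (\<Union>(a, s)\<in>A. loc_frac S (\<phi> ` W) (\<phi> a) (\<phi> s))"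

definition module_hom :: "('a, 'm) ring_scheme \<Rightarrow> ('a, 'b, 'n) module_scheme \<Rightarrow>
    ('a, 'c, 'k) module_scheme \<Rightarrow> ('b \<Rightarrow> 'c) set" where
  "module_hom R M N =
     {u \<in> carrier M \<rightarrow> carrier N.
        (\<forall>x\<in>carrier M. \<forall>y\<in>carrier M. u (x \<oplus>\<^bsub>M\<^esub> y) = u x \<oplus>\<^bsub>N\<^esub> u y) \<and>
        (\<forall>r\<in>carrier R. \<forall>x\<in>carrier M. u (r \<odot>\<^bsub>M\<^esub> x) = r \<odot>\<^bsub>N\<^esub> u x)}"

text \<open>The tensor product is built as an abelian group only: exactness does not refer to its
  scalar multiplication.\<close>

definition tensor_relators :: "('a, 'm) ring_scheme \<Rightarrow> ('a, 'b, 'n) module_scheme \<Rightarrow>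
    ('a, 'c, 'k) module_scheme \<Rightarrow> ('b \<times> 'c \<Rightarrow>\<^sub>0 int) set" where
  "tensor_relators R N M =
     {frag_of (x \<oplus>\<^bsub>N\<^esub> y, m) - frag_of (x, m) - frag_of (y, m) | x y m.
        x \<in> carrier N \<and> y \<in> carrier N \<and> m \<in> carrier M} \<union>
     {frag_of (x, m \<oplus>\<^bsub>M\<^esub> n) - frag_of (x, m) - frag_of (x, n) | x m n.
        x \<in> carrier N \<and> m \<in> carrier M \<and> n \<in> carrier M} \<union>
     {frag_of (r \<odot>\<^bsub>N\<^esub> x, m) - frag_of (x, r \<odot>\<^bsub>M\<^esub> m) | r x m.
        r \<in> carrier R \<and> x \<in> carrier N \<and> m \<in> carrier M}"

definition tensor_kernel :: "('a, 'm) ring_scheme \<Rightarrow> ('a, 'b, 'n) module_scheme \<Rightarrow>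
    ('a, 'c, 'k) module_scheme \<Rightarrow> ('b \<times> 'c \<Rightarrow>\<^sub>0 int) set" where
  "tensor_kernel R N M =
     generate (free_Abelian_group (carrier N \<times> carrier M)) (tensor_relators R N M)"

definition tensor :: "('a, 'm) ring_scheme \<Rightarrow> ('a, 'b, 'n) module_scheme \<Rightarrow>
    ('a, 'c, 'k) module_scheme \<Rightarrow> ('b \<times> 'c \<Rightarrow>\<^sub>0 int) set monoid" where
  "tensor R N M = free_Abelian_group (carrier N \<times> carrier M) Mod tensor_kernel R N M"

text \<open>The map \<open>u \<otimes> id\<close> from \<open>L \<otimes> M\<close> to \<open>N \<otimes> M\<close>, for \<open>u : L \<rightarrow> N\<close>.\<close>

definition tensor_map :: "('a, 'm) ring_scheme \<Rightarrow> ('a, 'b, 'n) module_scheme \<Rightarrow>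
    ('a, 'c, 'k) module_scheme \<Rightarrow> ('d \<Rightarrow> 'b) \<Rightarrow>
    ('d \<times> 'c \<Rightarrow>\<^sub>0 int) set \<Rightarrow> ('b \<times> 'c \<Rightarrow>\<^sub>0 int) set" where
  "tensor_map R N M u A =
     (\<Union>z\<in>A. tensor_kernel R N M #>\<^bsub>free_Abelian_group (carrier N \<times> carrier M)\<^esub>
              frag_extend (\<lambda>(x, m). frag_of (u x, m)) z)"

text \<open>\<open>M\<close> is faithfully flat if a sequence \<open>N1 \<rightarrow> N2 \<rightarrow> N3\<close> of \<open>R\<close>-modules is exact if and only
  if it is exact after tensoring with \<open>M\<close>. A predicate cannot quantify over modules on all
  types; here they range over those with carrier in the type \<^typ>\<open>(nat \<Rightarrow> 'a) set\<close>. Every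
  countably generated \<open>R\<close>-module is isomorphic to one of these, as a set of cosets in the free
  module of finitely supported sequences. This is no loss: faithful flatness already follows
  from the sequences \<open>0 \<rightarrow> I \<rightarrow> R\<close> with \<open>I\<close> an ideal and \<open>0 \<rightarrow> R/I \<rightarrow> 0\<close> with \<open>I\<close> maximal.\<close>

definition faithfully_flat ::
    "('a, 'm) ring_scheme \<Rightarrow> ('a, 'b, 'n) module_scheme \<Rightarrow> bool" where
  "faithfully_flat R M \<longleftrightarrow>
     (\<forall>(N1 :: ('a, (nat \<Rightarrow> 'a) set) module) (N2 :: ('a, (nat \<Rightarrow> 'a) set) module)
        (N3 :: ('a, (nat \<Rightarrow> 'a) set) module).
      \<forall>u \<in> module_hom R N1 N2. \<forall>v \<in> module_hom R N2 N3.
        module R N1 \<and> module R N2 \<and> module R N3 \<longrightarrow>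
        (u ` carrier N1 = a_kernel N2 N3 v \<longleftrightarrow>
         tensor_map R N2 M u ` carrier (tensor R N1 M) =
           kernel (tensor R N2 M) (tensor R N3 M) (tensor_map R N3 M v)))"

end

theory Submission
  imports Defs
begin

text \<open>Faithful flatness enters only through \<open>IS \<inter> R = I\<close> for ideals \<open>I\<close> of \<open>R\<close>.

  Let \<open>f\<close> be a nonzero element of \<open>S\<close>. Only finitely many maximal ideals \<open>\<mm>\<close> satisfy
  \<open>f \<in> \<mm>S\<close>: for each of them choose \<open>b/a\<close> in the inverse of \<open>\<mm>\<close> but not in \<open>R\<close>; then
  \<open>f b/a \<in> S\<close>. Since \<open>S\<close> is Noetherian, finitely many of the maximal ideals suffice for every
  \<open>d\<close> in all of these to multiply every \<open>f b/a\<close> into \<open>f S\<close>. For another maximal ideal \<open>\<nn>\<close> of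
  the family take \<open>d \<notin> \<nn>\<close>; then \<open>d b/a \<in> S\<close>, hence \<open>d b/a \<in> R\<close>, and together with
  \<open>\<nn> b/a \<subseteq> R\<close> this puts \<open>b/a\<close> into \<open>R\<close>.

  For each of these \<open>\<mm>\<close>, let \<open>Q(\<mm>)\<close> be the contraction to \<open>R\<close> of the content of \<open>f\<close> over
  \<open>R\<^sub>\<mm>\<close>. It is nonzero, so in dimension 1 the only maximal ideal that can contain it is
  \<open>\<mm>\<close>. Both \<open>f \<in> CS\<close> for the finite intersection \<open>C\<close> of the \<open>Q(\<mm>)\<close> and the inclusion
  \<open>C \<subseteq> I\<close> for every ideal \<open>I\<close> with \<open>f \<in> IS\<close> can therefore be checked locally.\<close>

section \<open>Ideals in one-dimensional domains\<close>

lemma (in cring) idealI_closed: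
  assumes "I \<subseteq> carrier R" "\<zero> \<in> I" "\<And>x y. x \<in> I \<Longrightarrow> y \<in> I \<Longrightarrow> x \<oplus> y \<in> I"
    and mult: "\<And>r x. r \<in> carrier R \<Longrightarrow> x \<in> I \<Longrightarrow> r \<otimes> x \<in> I"
  shows "ideal I R"
proof (rule idealI[OF ring_axioms])
  show "subgroup I (add_monoid R)"
  proof
    fix x assume x: "x \<in> I"
    have "\<ominus> x = \<ominus> \<one> \<otimes> x"
      using x assms(1) l_minus[of \<one> x] by auto
    then show "inv\<^bsub>add_monoid R\<^esub> x \<in> I"
      using mult[of "\<ominus> \<one>" x] x unfolding a_inv_def[symmetric] by auto
  qed (use assms in auto)
  show "x \<otimes> a \<in> I" "a \<otimes> x \<in> I" if "a \<in> I" "x \<in> carrier R" for a x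
    using mult[OF that(2,1)] that assms(1) by (auto simp: m_comm)
qed

lemma (in cring) colon_ideal:
  assumes "ideal J R" "c \<in> carrier R"
  shows "ideal {x \<in> carrier R. c \<otimes> x \<in> J} R"
proof -
  interpret J: ideal J R by fact
  show ?thesis
  proof (rule idealI_closed)
    show "r \<otimes> x \<in> {x \<in> carrier R. c \<otimes> x \<in> J}"
      if "r \<in> carrier R" "x \<in> {x \<in> carrier R. c \<otimes> x \<in> J}" for r x
      using that J.I_l_closed[of "c \<otimes> x" r] assms(2) by (simp add: m_lcomm)
  qed (use assms(2) in \<open>auto simp: r_distr\<close>)
qed

text \<open>The elements that \<open>c\<close> multiplies into \<open>J\<close> form an ideal, so
  testing generators is enough. Products with extended ideals are handled this way below.\<close>

lemma (in cring) mult_genideal: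
  assumes "ideal J R" "c \<in> carrier R" "B \<subseteq> carrier R"
    and "\<And>y. y \<in> B \<Longrightarrow> c \<otimes> y \<in> J" "x \<in> Idl B"
  shows "c \<otimes> x \<in> J"
  using genideal_minimal[OF colon_ideal[OF assms(1,2)], of B] assms(3-5) by auto

text \<open>Zorn's lemma on the ideals above \<open>J\<close> that avoid \<open>W\<close>. The set
  \<open>W\<close> is arbitrary: \<open>{\<one>}\<close> leads to maximal ideals, a multiplicative
  set to primes.\<close>

lemma (in cring) maximal_disjoint_ideal:
  assumes "ideal J R" "J \<inter> W = {}"
  obtains P where "ideal P R" "J \<subseteq> P" "P \<inter> W = {}"
    "\<And>I. ideal I R \<Longrightarrow> P \<subseteq> I \<Longrightarrow> I \<inter> W = {} \<Longrightarrow> I = P"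
proof -
  define \<A> where "\<A> = {I. ideal I R \<and> J \<subseteq> I \<and> I \<inter> W = {}}"
  have "\<exists>P\<in>\<A>. \<forall>I\<in>\<A>. P \<subseteq> I \<longrightarrow> I = P"
  proof (rule subset_Zorn_nonempty)
    show "\<A> \<noteq> {}"
      using assms unfolding \<A>_def by blast
    fix C assume C: "C \<noteq> {}" "subset.chain \<A> C"
    then have "subset.chain {I. ideal I R} C"
      unfolding \<A>_def pred_on.chain_def by auto
    from chain_Union_is_ideal[OF this] have "ideal (\<Union>C) R"
      using C(1) by simp
    with C show "\<Union>C \<in> \<A>"
      unfolding \<A>_def pred_on.chain_def by blast
  qed
  then obtain P where "P \<in> \<A>" "\<forall>I\<in>\<A>. P \<subseteq> I \<longrightarrow> I = P"
    by blast
  then show thesis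
    by (intro that[of P]) (auto simp: \<A>_def)
qed

text \<open>Krull's argument with colon ideals: if \<open>a \<otimes> b\<close> is in
  \<open>P\<close> but \<open>a\<close> and \<open>b\<close> are not, then \<open>(P : a)\<close> is
  strictly larger than \<open>P\<close> and contains some \<open>w\<close> in \<open>W\<close>.
  Hence \<open>(P : w)\<close> contains \<open>a\<close>, is strictly larger too and contains some
  \<open>v\<close> in \<open>W\<close>; now \<open>w \<otimes> v\<close> lies in both
  \<open>P\<close> and \<open>W\<close>.\<close>

lemma (in cring) maximal_disjoint_ideal_is_prime:
  assumes P: "ideal P R" "P \<inter> W = {}"
    and max: "\<And>I. ideal I R \<Longrightarrow> P \<subseteq> I \<Longrightarrow> I \<inter> W = {} \<Longrightarrow> I = P"
    and W: "\<one> \<in> W" "\<And>x y. x \<in> W \<Longrightarrow> y \<in> W \<Longrightarrow> x \<otimes> y \<in> W"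
  shows "primeideal P R"
proof (rule primeidealI[OF P(1) is_cring])
  interpret P: ideal P R by fact
  show "carrier R \<noteq> P"
    using P W by auto
  fix a b assume ab: "a \<in> carrier R" "b \<in> carrier R" "a \<otimes> b \<in> P"
  show "a \<in> P \<or> b \<in> P"
  proof (rule ccontr)
    assume n: "\<not> (a \<in> P \<or> b \<in> P)"
    define A where "A = {x \<in> carrier R. a \<otimes> x \<in> P}"
    have A: "ideal A R"
      unfolding A_def using colon_ideal P ab by auto
    have "P \<subseteq> A"
      using ab P.I_l_closed unfolding A_def by auto
    moreover have "b \<in> A"
      using ab unfolding A_def by auto
    ultimately have "A \<inter> W \<noteq> {}"
      using max[OF A] n by auto
    then obtain w where w: "w \<in> W" "w \<in> carrier R" "w \<otimes> a \<in> P"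
      using ab unfolding A_def by (auto simp: m_comm)
    define B where "B = {x \<in> carrier R. w \<otimes> x \<in> P}"
    have B: "ideal B R"
      unfolding B_def using colon_ideal P w by auto
    have "P \<subseteq> B"
      using w P.I_l_closed unfolding B_def by auto
    moreover have "a \<in> B"
      using w ab unfolding B_def by auto
    ultimately have "B \<inter> W \<noteq> {}"
      using max[OF B] n by auto
    then obtain v where "v \<in> W" "w \<otimes> v \<in> P"
      unfolding B_def by auto
    with W(2)[OF w(1)] P(2) show False
      by auto
  qed
qed

text \<open>The local-to-global principle of the final argument: an ideal of multipliers is the unit
  ideal once no maximal ideal contains it. An ideal maximal among those that avoid
  \<open>\<one>\<close> is a maximal ideal.\<close>

lemma (in cring) ideal_eq_carrier_if_not_in_maximal:
  assumes "ideal J R" and "\<And>M. maximalideal M R \<Longrightarrow> \<not> J \<subseteq> M"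
  shows "J = carrier R"
proof (rule ccontr)
  assume "J \<noteq> carrier R"
  then have "\<one> \<notin> J"
    using ideal.one_imp_carrier[OF assms(1)] by auto
  then obtain P where P: "ideal P R" "J \<subseteq> P" "P \<inter> {\<one>} = {}"
    and max: "\<And>I. ideal I R \<Longrightarrow> P \<subseteq> I \<Longrightarrow> I \<inter> {\<one>} = {} \<Longrightarrow> I = P"
    using maximal_disjoint_ideal[OF assms(1), of "{\<one>}"] by auto
  have "maximalideal P R"
  proof (rule maximalidealI[OF P(1)])
    show "carrier R \<noteq> P"
      using P by auto
    show "I = P \<or> I = carrier R" if "ideal I R" "P \<subseteq> I" for I
      using max[OF that] ideal.one_imp_carrier[OF that(1)] by auto
  qed
  with assms(2) P(2) show False
    by auto
qed

section \<open>Maximal ideals and their complements\<close>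

lemma (in cring) maximal_not_subset:
  assumes "maximalideal M R" "maximalideal N R" "M \<noteq> N"
  shows "\<not> M \<subseteq> N"
proof
  interpret N: maximalideal N R by fact
  assume "M \<subseteq> N"
  then show False
    using maximalideal.I_maximal[OF assms(1) N.is_ideal] N.I_notcarr N.a_subset assms(3) by blast
qed

lemma (in cring) maximal_compl_mult:
  assumes "maximalideal M R" "x \<in> carrier R - M" "y \<in> carrier R - M"
  shows "x \<otimes> y \<in> carrier R - M"
  using primeideal.I_prime[OF maximalideal_prime[OF assms(1)], of x y] assms by auto

lemma (in cring) maximal_compl_one:
  assumes "maximalideal M R"
  shows "\<one> \<in> carrier R - M"
  using maximalideal.I_notcarr[OF assms] ideal.one_imp_carrier[OF maximalideal.axioms(1)[OF assms]]
  by auto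

lemma (in cring) maximal_compl_pow:
  assumes "maximalideal M R" "x \<in> carrier R - M"
  shows "x [^] (k::nat) \<in> carrier R - M"
proof (induction k)
  case (Suc k)
  then show ?case
    using maximal_compl_mult[OF assms(1) Suc assms(2)] by simp
qed (use maximal_compl_one[OF assms(1)] in simp)

text \<open>Otherwise the zero ideal, \<open>P\<close> and \<open>Q\<close> would be a strict chain
  of primes of length 2.\<close>

lemma (in domain) nonzero_prime_not_below_prime:
  assumes dim: "krull_dim R \<le> 1"
    and P: "primeideal P R" "P \<noteq> {\<zero>}" and Q: "primeideal Q R" "P \<subseteq> Q"
  shows "P = Q"
proof (rule ccontr)
  assume ne: "P \<noteq> Q"
  define p where "p = (\<lambda>i::nat. if i = 0 then {\<zero>} else if i = 1 then P else Q)"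
  have "{\<zero>} \<subset> P"
    using P additive_subgroup.zero_closed[OF ideal.axioms(1)[OF primeideal.axioms(1)[OF P(1)]]] by auto
  then have "(\<forall>i\<le>2. primeideal (p i) R) \<and> (\<forall>i<2. p i \<subset> p (Suc i))"
    using P Q ne zeroprimeideal unfolding p_def by (auto simp: less_Suc_eq numeral_2_eq_2)
  then have "enat 2 \<le> krull_dim R"
    unfolding krull_dim_def by (intro Sup_upper) blast
  with dim have "enat 2 \<le> enat 1"
    unfolding one_enat_def by (rule order_trans[rotated])
  then show False
    by simp
qed

text \<open>After inverting the complement of \<open>M\<close>, every nonzero ideal is \<open>M\<close>-primary or the
  unit ideal.\<close>

lemma (in domain) power_in_nonzero_ideal:
  assumes dim: "krull_dim R \<le> 1" and M: "maximalideal M R"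
    and J: "ideal J R" "J \<noteq> {\<zero>}" and x: "x \<in> M"
  shows "\<exists>s\<in>carrier R - M. \<exists>k::nat. s \<otimes> x [^] k \<in> J"
proof (rule ccontr)
  assume contr: "\<not> ?thesis"
  interpret M: maximalideal M R by fact
  interpret J: ideal J R by fact
  have xR: "x \<in> carrier R"
    using x M.Icarr by auto
  \<comment> \<open>The multiplicative set generated by \<open>x\<close> and the complement of
    \<open>M\<close>. A prime above \<open>J\<close> that avoids it lies in \<open>M\<close> and is
    nonzero, so it equals \<open>M\<close> by the bound on the dimension; but \<open>x\<close> is in
    \<open>W\<close>.\<close>
  define W where "W = {s \<otimes> x [^] k | s k::nat. s \<in> carrier R - M}"
  have W: "s \<in> carrier R - M \<Longrightarrow> s \<otimes> x [^] k \<in> W" for s and k :: nat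
    unfolding W_def by blast
  have "J \<inter> W = {}"
    using contr unfolding W_def by auto
  from maximal_disjoint_ideal[OF J(1) this] obtain P where P: "ideal P R" "J \<subseteq> P" "P \<inter> W = {}"
    "\<And>I. ideal I R \<Longrightarrow> P \<subseteq> I \<Longrightarrow> I \<inter> W = {} \<Longrightarrow> I = P"
    by blast
  have one: "\<one> \<in> W"
    using W[OF maximal_compl_one[OF M], of 0] by simp
  have "u \<otimes> v \<in> W" if uv: "u \<in> W" "v \<in> W" for u v
  proof -
    from uv obtain s k t l where *: "s \<in> carrier R - M" "u = s \<otimes> x [^] (k::nat)"
      "t \<in> carrier R - M" "v = t \<otimes> x [^] (l::nat)"
      unfolding W_def by auto
    then have "u \<otimes> v = (s \<otimes> t) \<otimes> x [^] (k + l)"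
      using xR by (simp add: nat_pow_mult[symmetric] m_ac)
    with * W[OF maximal_compl_mult[OF M *(1,3)], of "k + l"] show ?thesis
      by simp
  qed
  then have prime: "primeideal P R"
    using maximal_disjoint_ideal_is_prime[OF P(1,3,4) one] by blast
  have "s \<in> W" if "s \<in> carrier R - M" for s
    using W[OF that, of 0] that by simp
  then have "P \<subseteq> M"
    using P(3) ideal.Icarr[OF P(1)] by blast
  moreover have "P \<noteq> {\<zero>}"
    using P(2) J(2) J.zero_closed by auto
  ultimately have "P = M"
    using nonzero_prime_not_below_prime[OF dim prime] maximalideal_prime[OF M] by blast
  moreover have "x \<in> W"
    using W[OF maximal_compl_one[OF M], of 1] xR by simp
  ultimately show False
    using P(3) x by auto
qed

text \<open>For \<open>J\<close> principal, dividing \<open>b\<close> by the generator gives an element of the inverse of \<open>M\<close>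
  outside of the ring.\<close>

lemma (in domain) maximal_ideal_annihilates_modulo:
  assumes dim: "krull_dim R \<le> 1" and M: "maximalideal M R"
    and J: "ideal J R" "J \<noteq> {\<zero>}" "J \<subseteq> M"
    and A: "finite A" "A \<subseteq> M" "M \<subseteq> Idl A"
  shows "\<exists>b\<in>carrier R - J. \<forall>y\<in>M. b \<otimes> y \<in> J"
proof -
  interpret M: maximalideal M R by fact
  interpret J: ideal J R by fact
  \<comment> \<open>The condition \<open>b \<notin> J\<close> is strengthened: \<open>b\<close>
    stays nonzero in \<open>R/J\<close> localized at \<open>M\<close>. This form survives the
    induction over the generators.\<close>
  have "\<exists>b\<in>carrier R. (\<forall>s\<in>carrier R - M. s \<otimes> b \<notin> J) \<and> (\<forall>y\<in>A. b \<otimes> y \<in> J)"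
    using A(1,2)
  proof (induction A)
    case empty
    show ?case
      using J(3) by (intro bexI[of _ \<one>]) auto
  next
    case (insert y A)
    then obtain b where b: "b \<in> carrier R" "\<And>s. s \<in> carrier R - M \<Longrightarrow> s \<otimes> b \<notin> J"
      "\<And>y. y \<in> A \<Longrightarrow> b \<otimes> y \<in> J"
      by auto
    have y: "y \<in> M" "y \<in> carrier R"
      using insert M.Icarr by auto
    \<comment> \<open>\<open>Z k\<close> says that \<open>y [^] k \<otimes> b\<close> becomes zero
      in that localization. It holds for some \<open>k\<close> but not for 0. At the least
      \<open>k\<close>, the element with exponent \<open>k - 1\<close> is still nonzero there, and
      its multiple by \<open>s\<close> is killed by \<open>y\<close> modulo
      \<open>J\<close>.\<close>
    define Z where "Z = (\<lambda>k::nat. \<exists>s\<in>carrier R - M. s \<otimes> y [^] k \<otimes> b \<in> J)"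
    have "\<exists>k. Z k"
      using power_in_nonzero_ideal[OF dim M J(1,2) y(1)] b(1) J.I_r_closed
      unfolding Z_def by blast
    then obtain k where k: "Z k" "\<And>j. j < k \<Longrightarrow> \<not> Z j"
      using exists_least_iff[of Z] by auto
    have "\<not> Z 0"
      using b(1,2) unfolding Z_def by auto
    then have "k \<noteq> 0"
      using k(1) by metis
    then obtain j where j: "k = Suc j"
      using not0_implies_Suc by auto
    obtain s where s: "s \<in> carrier R - M" "s \<otimes> y [^] k \<otimes> b \<in> J"
      using k(1) unfolding Z_def by auto
    define c where "c = s \<otimes> y [^] j \<otimes> b"
    have c: "c \<in> carrier R"
      using s b y unfolding c_def by auto
    have "t \<otimes> c \<notin> J" if t: "t \<in> carrier R - M" for t
    proof
      assume "t \<otimes> c \<in> J"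
      moreover have "t \<otimes> c = (t \<otimes> s) \<otimes> y [^] j \<otimes> b"
        using t s y b unfolding c_def by (simp add: m_assoc)
      ultimately have "Z j"
        using maximal_compl_mult[OF M t s(1)] unfolding Z_def by auto
      with k(2)[of j] j show False
        by simp
    qed
    moreover have "c \<otimes> y \<in> J"
      using s y b unfolding c_def j by (simp add: m_ac)
    moreover have "c \<otimes> z \<in> J" if "z \<in> A" for z
    proof -
      have z: "z \<in> carrier R"
        using that insert M.Icarr by auto
      have "c \<otimes> z = (s \<otimes> y [^] j) \<otimes> (b \<otimes> z)"
        using s y b z unfolding c_def by (simp add: m_assoc)
      then show ?thesis
        using J.I_l_closed[OF b(3)[OF that], of "s \<otimes> y [^] j"] s y by simp
    qed
    ultimately show ?case
      using c by auto
  qed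
  then obtain b where b: "b \<in> carrier R" "\<And>s. s \<in> carrier R - M \<Longrightarrow> s \<otimes> b \<notin> J"
    "\<And>y. y \<in> A \<Longrightarrow> b \<otimes> y \<in> J"
    by auto
  have "b \<notin> J"
    using b(2)[OF maximal_compl_one[OF M]] b(1) by simp
  moreover have "b \<otimes> y \<in> J" if "y \<in> M" for y
    using mult_genideal[OF J(1) b(1) _ b(3)] that A M.Icarr by blast
  ultimately show ?thesis
    using b(1) by auto
qed

section \<open>Extension of ideals and faithful flatness\<close>

lemma (in cring) finsum_module_of_hom:
  fixes n :: nat
  assumes f: "f \<in> {..<n} \<rightarrow> carrier R"
  shows "finsum (module_of_hom R \<phi>) f {..<n} = finsum R f {..<n}"
proof -
  let ?M = "module_of_hom R \<phi>"
  interpret M: abelian_monoid ?M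
    by unfold_locales (auto simp: module_of_hom_def a_ac)
  have [simp]: "carrier ?M = carrier R" "\<zero>\<^bsub>?M\<^esub> = \<zero>" "\<And>x y. x \<oplus>\<^bsub>?M\<^esub> y = x \<oplus> y"
    by (simp_all add: module_of_hom_def)
  show ?thesis
    using f
  proof (induction n)
    case (Suc n)
    then have "f \<in> {..<n} \<rightarrow> carrier R" "f n \<in> carrier R"
      by auto
    with Suc.IH show ?case
      by (simp add: lessThan_Suc)
  qed simp
qed

lemma (in abelian_monoid) finsum_lessThan_add:
  fixes n m :: nat
  assumes "f \<in> {..<n + m} \<rightarrow> carrier G"
  shows "finsum G f {..<n + m} = finsum G f {..<n} \<oplus> finsum G (\<lambda>k. f (n + k)) {..<m}"
  using assms
proof (induction m)
  case (Suc m)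
  have "f \<in> {..<n} \<rightarrow> carrier G" "f \<in> {..<n + m} \<rightarrow> carrier G" "f (n + m) \<in> carrier G"
    "(\<lambda>k. f (n + k)) \<in> {..<m} \<rightarrow> carrier G"
    using Suc.prems by (auto simp: Pi_iff)
  with Suc.IH show ?case
    by (simp add: lessThan_Suc a_lcomm)
qed auto

text \<open>Here \<open>R\<close> is the target ring. The finite sums form an ideal that contains
  the image of \<open>I\<close> and lies in every ideal containing it. This turns the product
  \<open>IS\<close> in the definition of content into a generated ideal, the form used from here
  on.\<close>

lemma (in cring) ideal_smult_eq_genideal:
  assumes I: "\<phi> ` I \<subseteq> carrier R"
  shows "ideal_smult I (module_of_hom R \<phi>) = Idl (\<phi> ` I)"
proof -
  define L where "L = {finsum R (\<lambda>k. \<phi> (a k) \<otimes> x k) {..<n} | (n::nat) a x.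
        a \<in> {..<n} \<rightarrow> I \<and> x \<in> {..<n} \<rightarrow> carrier R}"
  have closed: "\<phi> a \<in> carrier R" if "a \<in> I" for a
    using that I by auto
  have eq: "ideal_smult I (module_of_hom R \<phi>) = L"
  proof -
    have *: "finsum (module_of_hom R \<phi>) (\<lambda>k. \<phi> (a k) \<otimes> x k) {..<n} =
        finsum R (\<lambda>k. \<phi> (a k) \<otimes> x k) {..<n}"
      if "a \<in> {..<n} \<rightarrow> I \<and> x \<in> {..<n} \<rightarrow> carrier R" for a x and n :: nat
      using that closed by (intro finsum_module_of_hom) (auto simp: Pi_iff)
    have [simp]: "carrier (module_of_hom R \<phi>) = carrier R"
      "\<And>a x. a \<odot>\<^bsub>module_of_hom R \<phi>\<^esub> x = \<phi> a \<otimes> x"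
      by (simp_all add: module_of_hom_def)
    show ?thesis
      unfolding ideal_smult_def L_def using * by (simp cong: conj_cong) (metis (no_types, lifting) *)
  qed
  have L: "ideal L R"
  proof (rule idealI_closed)
    show "L \<subseteq> carrier R"
      unfolding L_def using closed by (auto simp: Pi_iff intro!: finsum_closed)
    show "\<zero> \<in> L"
      unfolding L_def by (rule CollectI, rule exI[of _ 0]) auto
    show "r \<otimes> y \<in> L" if r: "r \<in> carrier R" and y: "y \<in> L" for r y
    proof -
      obtain n a x where *: "a \<in> {..<n::nat} \<rightarrow> I" "x \<in> {..<n} \<rightarrow> carrier R"
        "y = finsum R (\<lambda>k. \<phi> (a k) \<otimes> x k) {..<n}"
        using y unfolding L_def by auto
      have "r \<otimes> y = finsum R (\<lambda>k. r \<otimes> (\<phi> (a k) \<otimes> x k)) {..<n}"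
        unfolding *(3) using * closed r by (intro finsum_rdistr) auto
      also have "\<dots> = finsum R (\<lambda>k. \<phi> (a k) \<otimes> (r \<otimes> x k)) {..<n}"
        using * closed r by (intro finsum_cong') (auto simp: Pi_iff m_lcomm)
      finally show ?thesis
        unfolding L_def using * r
        by (intro CollectI exI[of _ n] exI[of _ a] exI[of _ "\<lambda>k. r \<otimes> x k"]) auto
    qed
    show "y \<oplus> z \<in> L" if yz: "y \<in> L" "z \<in> L" for y z
    proof -
      obtain n a x where y: "a \<in> {..<n::nat} \<rightarrow> I" "x \<in> {..<n} \<rightarrow> carrier R"
        "y = finsum R (\<lambda>k. \<phi> (a k) \<otimes> x k) {..<n}"
        using yz unfolding L_def by auto
      obtain m b w where z: "b \<in> {..<m::nat} \<rightarrow> I" "w \<in> {..<m} \<rightarrow> carrier R"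
        "z = finsum R (\<lambda>k. \<phi> (b k) \<otimes> w k) {..<m}"
        using yz unfolding L_def by auto
      define c where "c k = (if k < n then a k else b (k - n))" for k
      define v where "v k = (if k < n then x k else w (k - n))" for k
      have cv: "c \<in> {..<n + m} \<rightarrow> I" "v \<in> {..<n + m} \<rightarrow> carrier R"
        using y z unfolding c_def v_def by (auto simp: Pi_iff)
      have "finsum R (\<lambda>k. \<phi> (c k) \<otimes> v k) {..<n + m} =
          finsum R (\<lambda>k. \<phi> (c k) \<otimes> v k) {..<n} \<oplus> finsum R (\<lambda>k. \<phi> (c (n + k)) \<otimes> v (n + k)) {..<m}"
        using cv closed by (intro finsum_lessThan_add) (auto simp: Pi_iff)
      also have "finsum R (\<lambda>k. \<phi> (c k) \<otimes> v k) {..<n} = y"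
        unfolding y(3) using y closed by (intro finsum_cong') (auto simp: c_def v_def Pi_iff)
      also have "finsum R (\<lambda>k. \<phi> (c (n + k)) \<otimes> v (n + k)) {..<m} = z"
        unfolding z(3) using z closed by (intro finsum_cong') (auto simp: c_def v_def Pi_iff)
      finally show ?thesis
        unfolding L_def using cv
        by (intro CollectI exI[of _ "n + m"] exI[of _ c] exI[of _ v]) auto
    qed
  qed
  have "\<phi> ` I \<subseteq> L"
  proof
    fix y assume "y \<in> \<phi> ` I"
    then obtain i where i: "i \<in> I" "y = \<phi> i"
      by auto
    then have "y = finsum R (\<lambda>k. \<phi> i \<otimes> \<one>) {..<Suc 0}"
      using closed[of i] by (simp add: lessThan_Suc)
    then show "y \<in> L"
      unfolding L_def using i
      by (intro CollectI exI[of _ "Suc 0"] exI[of _ "\<lambda>_. i"] exI[of _ "\<lambda>_. \<one>"]) auto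
  qed
  then have "Idl (\<phi> ` I) \<subseteq> L"
    using genideal_minimal[OF L] by simp
  moreover have "L \<subseteq> Idl (\<phi> ` I)"
  proof
    interpret J: ideal "Idl (\<phi> ` I)" R
      using genideal_ideal[OF I] .
    have "finsum R (\<lambda>k. \<phi> (a k) \<otimes> x k) {..<n} \<in> Idl (\<phi> ` I)"
      if "a \<in> {..<n} \<rightarrow> I" "x \<in> {..<n} \<rightarrow> carrier R" for a x and n :: nat
      using that
    proof (induction n)
      case (Suc n)
      then have *: "a n \<in> I" "x n \<in> carrier R" "a \<in> {..<n} \<rightarrow> I" "x \<in> {..<n} \<rightarrow> carrier R"
        by (auto simp: Pi_iff)
      have "\<phi> (a n) \<otimes> x n \<in> Idl (\<phi> ` I)"
        using J.I_r_closed * genideal_self[OF I] by blast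
      with Suc.IH * closed show ?case
        by (auto simp: lessThan_Suc Pi_iff)
    qed simp
    then show "y \<in> Idl (\<phi> ` I)" if "y \<in> L" for y
      using that unfolding L_def by auto
  qed
  ultimately show ?thesis
    using eq by simp
qed

text \<open>The content is the intersection of all ideals \<open>I\<close> with \<open>f\<close> in
  \<open>IS\<close>. It satisfies this condition itself if and only if a least such ideal exists,
  and then it is that ideal.\<close>

lemma ohm_rush_iff:
  assumes "cring R" "cring S" "\<phi> \<in> ring_hom R S"
  shows "ohm_rush R S \<phi> \<longleftrightarrow>
    (\<forall>f\<in>carrier S. \<exists>J. ideal J R \<and> f \<in> Idl\<^bsub>S\<^esub> (\<phi> ` J) \<and>
       (\<forall>I. ideal I R \<longrightarrow> f \<in> Idl\<^bsub>S\<^esub> (\<phi> ` I) \<longrightarrow> J \<subseteq> I))"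
proof -
  interpret R: cring R by fact
  interpret S: cring S by fact
  have hom: "\<phi> ` I \<subseteq> carrier S" if "I \<subseteq> carrier R" for I
    using that ring_hom_closed[OF assms(3)] by auto
  have smult: "ideal_smult I (module_of_hom S \<phi>) = Idl\<^bsub>S\<^esub> (\<phi> ` I)" if "ideal I R" for I
    using S.ideal_smult_eq_genideal[OF hom[OF additive_subgroup.a_subset[OF ideal.axioms(1)[OF that]]]] .
  have "f \<in> ideal_smult (ohm_rush_content R (module_of_hom S \<phi>) f) (module_of_hom S \<phi>) \<longleftrightarrow>
    (\<exists>J. ideal J R \<and> f \<in> Idl\<^bsub>S\<^esub> (\<phi> ` J) \<and> (\<forall>I. ideal I R \<longrightarrow> f \<in> Idl\<^bsub>S\<^esub> (\<phi> ` I) \<longrightarrow> J \<subseteq> I))"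
    (is "?l \<longleftrightarrow> (\<exists>J. ?r J)") if f: "f \<in> carrier S" for f
  proof -
    define C where "C = ohm_rush_content R (module_of_hom S \<phi>) f"
    have C: "C = \<Inter> {I. ideal I R \<and> f \<in> Idl\<^bsub>S\<^esub> (\<phi> ` I)}"
      unfolding C_def ohm_rush_content_def using smult by (metis (no_types, lifting))
    \<comment> \<open>The unit ideal is among the ideals intersected, so the family is nonempty and
      its intersection is an ideal.\<close>
    have "\<one>\<^bsub>S\<^esub> \<in> \<phi> ` carrier R"
      using ring_hom_one[OF assms(3)] by force
    then have "\<one>\<^bsub>S\<^esub> \<in> Idl\<^bsub>S\<^esub> (\<phi> ` carrier R)"
      using S.genideal_self[OF hom] by auto
    then have "f \<in> Idl\<^bsub>S\<^esub> (\<phi> ` carrier R)"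
      using ideal.one_imp_carrier[OF S.genideal_ideal[OF hom]] f by auto
    then have "ideal C R"
      unfolding C using R.oneideal by (intro R.i_Intersect) auto
    show ?thesis
    proof
      assume ?l
      then have "?r C"
        using smult[OF \<open>ideal C R\<close>] \<open>ideal C R\<close> unfolding C_def[symmetric] by (auto simp: C)
      then show "\<exists>J. ?r J" ..
    next
      assume "\<exists>J. ?r J"
      then obtain J where J: "?r J" ..
      then have "J = C"
        unfolding C by blast
      with J smult[of C] show ?l
        unfolding C_def[symmetric] by simp
    qed
  qed
  then show ?thesis
    unfolding ohm_rush_def by (auto simp: module_of_hom_def)
qed

text \<open>The module \<open>R/I\<close>, with its elements moved to the type over which faithful flatness
  quantifies.\<close>

definition quotient_module :: "('a, 'm) ring_scheme \<Rightarrow> 'a set \<Rightarrow> ('a, (nat \<Rightarrow> 'a) set) module" where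
  "quotient_module R I =
     \<lparr>carrier = (\<lambda>A. (\<lambda>x _. x) ` A) ` (a_rcosets\<^bsub>R\<^esub> I), monoid.mult = undefined, one = undefined,
      ring.zero = (\<lambda>x _. x) ` I,
      ring.add = (\<lambda>A B. (\<lambda>x _. x) ` ((\<lambda>g. g 0) ` A <+>\<^bsub>R\<^esub> (\<lambda>g. g 0) ` B)),
      smult = (\<lambda>r A. (\<lambda>x _. x) ` rcoset_mult R I (I +>\<^bsub>R\<^esub> r) ((\<lambda>g. g 0) ` A))\<rparr>"

definition quotient_module_class :: "('a, 'm) ring_scheme \<Rightarrow> 'a set \<Rightarrow> 'a \<Rightarrow> (nat \<Rightarrow> 'a) set" where
  "quotient_module_class R I r = (\<lambda>x _. x) ` (I +>\<^bsub>R\<^esub> r)"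

section \<open>The module structure on R/I\<close>

context ideal
begin

lemma carrier_quotient_module:
  "carrier (quotient_module R I) = quotient_module_class R I ` carrier R"
  unfolding quotient_module_def quotient_module_class_def A_RCOSETS_def' a_r_coset_def'
  by auto

lemma coset_zero: "I +> \<zero> = I"
  using a_rcos_zero[OF is_ideal, of \<zero>] by simp

lemma zero_quotient_module: "\<zero>\<^bsub>quotient_module R I\<^esub> = quotient_module_class R I \<zero>"
  unfolding quotient_module_def quotient_module_class_def
  by (simp add: coset_zero)

text \<open>Elements of a coset are encoded as constant sequences. Evaluation at 0 recovers the
  coset, which gives the operations of \<open>quotient_module\<close> access to those on
  cosets.\<close>

lemma decode_encode: "(\<lambda>g. g (0::nat)) ` (\<lambda>x _. x) ` A = A"
  by (simp add: image_image)

lemma add_quotient_module: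
  assumes "x \<in> carrier R" "y \<in> carrier R"
  shows "quotient_module_class R I x \<oplus>\<^bsub>quotient_module R I\<^esub> quotient_module_class R I y =
    quotient_module_class R I (x \<oplus> y)"
  using a_rcos_sum[OF assms]
  unfolding quotient_module_def quotient_module_class_def by (simp add: decode_encode)

lemma smult_quotient_module:
  assumes "x \<in> carrier R" "y \<in> carrier R"
  shows "x \<odot>\<^bsub>quotient_module R I\<^esub> quotient_module_class R I y =
    quotient_module_class R I (x \<otimes> y)"
  using rcoset_mult_add[OF assms]
  unfolding quotient_module_def quotient_module_class_def by (simp add: decode_encode)

lemma quotient_module_class_eq_zero_iff:
  assumes "x \<in> carrier R"
  shows "quotient_module_class R I x = quotient_module_class R I \<zero> \<longleftrightarrow> x \<in> I"
proof -
  have inj: "inj (\<lambda>x (_::nat). x :: 'a)"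
    by (auto simp: inj_def fun_eq_iff)
  show ?thesis
    unfolding quotient_module_class_def inj_image_eq_iff[OF inj] coset_zero
    using rcos_const_imp_mem[OF assms] a_rcos_zero[OF is_ideal] by blast
qed

lemmas quotient_module_simps =
  carrier_quotient_module zero_quotient_module add_quotient_module smult_quotient_module

lemma module_quotient_module:
  assumes "cring R"
  shows "module R (quotient_module R I)"
proof -
  interpret cring R by fact
  show ?thesis
  proof (rule moduleI[OF assms])
    show "abelian_group (quotient_module R I)"
    proof (rule abelian_groupI)
      fix x assume "x \<in> carrier (quotient_module R I)"
      then obtain r where "r \<in> carrier R" "x = quotient_module_class R I r"
        by (auto simp: carrier_quotient_module)
      then show "\<exists>y\<in>carrier (quotient_module R I). y \<oplus>\<^bsub>quotient_module R I\<^esub> x = \<zero>\<^bsub>quotient_module R I\<^esub>"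
        by (intro bexI[of _ "quotient_module_class R I (\<ominus> r)"]) (auto simp: quotient_module_simps l_neg)
    qed (auto simp: quotient_module_simps a_ac)
  qed (auto simp: quotient_module_simps l_distr r_distr m_assoc)
qed

end

text \<open>Multiplication by \<open>r\<close> on \<open>R/I\<close>, followed by the identity of \<open>R/I\<close>, is exact if and only if
  \<open>r \<in> I\<close>.\<close>

lemma faithfully_flat_contract_extension:
  assumes R: "cring R" and S: "cring S" and \<phi>: "\<phi> \<in> ring_hom R S"
    and ff: "faithfully_flat R (module_of_hom S \<phi>)"
    and I: "ideal I R" and r: "r \<in> carrier R" "\<phi> r \<in> Idl\<^bsub>S\<^esub> (\<phi> ` I)"
  shows "r \<in> I"
proof -
  interpret R: cring R by fact
  interpret S: cring S by fact
  interpret I: ideal I R by fact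
  define M where "M = module_of_hom S \<phi>"
  have M [simp]: "carrier M = carrier S" "\<And>x y. x \<oplus>\<^bsub>M\<^esub> y = x \<oplus>\<^bsub>S\<^esub> y" "\<And>a x. a \<odot>\<^bsub>M\<^esub> x = \<phi> a \<otimes>\<^bsub>S\<^esub> x"
    by (simp_all add: M_def module_of_hom_def)
  define N where "N = quotient_module R I"
  interpret N: module R N
    unfolding N_def using I.module_quotient_module[OF R] .
  define F where "F = free_Abelian_group (carrier N \<times> carrier M)"
  define K where "K = tensor_kernel R N M"
  define T where "T = tensor R N M"
  note \<phi>_closed [simp] = ring_hom_closed[OF \<phi>]
  interpret F: group F
    unfolding F_def by simp
  have F [simp]: "\<And>z. z \<in> carrier F \<longleftrightarrow> Poly_Mapping.keys z \<subseteq> carrier N \<times> carrier M"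
    "\<And>y z. y \<otimes>\<^bsub>F\<^esub> z = y + z" "\<one>\<^bsub>F\<^esub> = 0"
    "\<And>z. Poly_Mapping.keys z \<subseteq> carrier N \<times> carrier M \<Longrightarrow> inv\<^bsub>F\<^esub> z = - z"
    by (simp_all add: F_def)
  have diff: "x - y \<in> carrier F" if "x \<in> carrier F" "y \<in> carrier F" for x y
    using that keys_diff[of x y] by auto
  have rel: "tensor_relators R N M \<subseteq> carrier F"
  proof -
    have "frag_of (x, m) \<in> carrier F" if "x \<in> carrier N" "m \<in> carrier S" for x m
      using that by simp
    then show ?thesis
      unfolding tensor_relators_def by (auto simp del: F intro!: diff)
  qed
  interpret K: subgroup K F
    unfolding K_def tensor_kernel_def F_def[symmetric] using F.generate_is_subgroup[OF rel] .
  have K_add: "x + y \<in> K" if "x \<in> K" "y \<in> K" for x y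
    using K.m_closed[OF that] by simp
  have K_minus: "- x \<in> K" if "x \<in> K" for x
    using K.m_inv_closed[OF that] K.mem_carrier[OF that] by simp
  have K_diff: "x - y \<in> K" if "x \<in> K" "y \<in> K" for x y
    using K_add[OF that(1) K_minus[OF that(2)]] by simp
  have K_zero: "0 \<in> K"
    using K.one_closed by simp
  have K_rel: "x \<in> K" if "x \<in> tensor_relators R N M" for x
    unfolding K_def tensor_kernel_def using that by (rule generate.incl)
  have rel1: "frag_of (x \<oplus>\<^bsub>N\<^esub> y, m) - frag_of (x, m) - frag_of (y, m) \<in> K"
    if "x \<in> carrier N" "y \<in> carrier N" "m \<in> carrier S" for x y m
    using that by (intro K_rel) (auto simp: tensor_relators_def)
  have rel2: "frag_of (x, m \<oplus>\<^bsub>S\<^esub> n) - frag_of (x, m) - frag_of (x, n) \<in> K"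
    if "x \<in> carrier N" "m \<in> carrier S" "n \<in> carrier S" for x m n
    using that by (intro K_rel) (auto simp: tensor_relators_def)
  have rel3: "frag_of (a \<odot>\<^bsub>N\<^esub> x, m) - frag_of (x, \<phi> a \<otimes>\<^bsub>S\<^esub> m) \<in> K"
    if "a \<in> carrier R" "x \<in> carrier N" "m \<in> carrier S" for a x m
    using that by (intro K_rel) (auto simp: tensor_relators_def)
  \<comment> \<open>The relator for the sum of zero and zero collapses to the negative of a single
    generator.\<close>
  have zero1: "frag_of (\<zero>\<^bsub>N\<^esub>, m) \<in> K" if "m \<in> carrier S" for m
    using K_minus[OF rel1[of "\<zero>\<^bsub>N\<^esub>" "\<zero>\<^bsub>N\<^esub>" m]] that by simp
  have zero2: "frag_of (x, \<zero>\<^bsub>S\<^esub>) \<in> K" if "x \<in> carrier N" for x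
    using K_minus[OF rel2[of x "\<zero>\<^bsub>S\<^esub>" "\<zero>\<^bsub>S\<^esub>"]] that by simp
  \<comment> \<open>The elements \<open>g\<close> such that every pure tensor of some
    \<open>x\<close> with a multiple \<open>s g\<close> vanishes; the factor \<open>s\<close> makes
    \<open>L\<close> closed under multiplication. It contains the image of \<open>I\<close>, because
    \<open>i\<close> kills \<open>R/I\<close> and scalars move across the tensor sign. Hence it
    contains \<open>\<phi> r\<close>.\<close>
  define L where "L = {g \<in> carrier S. \<forall>s\<in>carrier S. \<forall>x\<in>carrier N. frag_of (x, s \<otimes>\<^bsub>S\<^esub> g) \<in> K}"
  have "ideal L S"
  proof (rule S.idealI_closed)
    show "\<zero>\<^bsub>S\<^esub> \<in> L"
      unfolding L_def using zero2 by simp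
    show "g \<oplus>\<^bsub>S\<^esub> h \<in> L" if "g \<in> L" "h \<in> L" for g h
    proof -
      have gh: "g \<in> carrier S" "h \<in> carrier S"
        using that unfolding L_def by auto
      have "frag_of (x, s \<otimes>\<^bsub>S\<^esub> (g \<oplus>\<^bsub>S\<^esub> h)) \<in> K" if s: "s \<in> carrier S" and x: "x \<in> carrier N" for s x
      proof -
        have "frag_of (x, s \<otimes>\<^bsub>S\<^esub> g) \<in> K" "frag_of (x, s \<otimes>\<^bsub>S\<^esub> h) \<in> K"
          using \<open>g \<in> L\<close> \<open>h \<in> L\<close> s x unfolding L_def by auto
        from K_add[OF K_add[OF rel2[OF x, of "s \<otimes>\<^bsub>S\<^esub> g" "s \<otimes>\<^bsub>S\<^esub> h"] this(1)] this(2)] show ?thesis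
          using s gh by (simp add: S.r_distr)
      qed
      with gh show ?thesis
        unfolding L_def by auto
    qed
    show "a \<otimes>\<^bsub>S\<^esub> g \<in> L" if "a \<in> carrier S" "g \<in> L" for a g
      using that unfolding L_def by (auto simp: S.m_assoc[symmetric])
  qed (auto simp: L_def)
  moreover have "\<phi> i \<in> L" if i: "i \<in> I" for i
  proof -
    have iR: "i \<in> carrier R"
      using i I.Icarr by auto
    have "frag_of (x, s \<otimes>\<^bsub>S\<^esub> \<phi> i) \<in> K" if s: "s \<in> carrier S" and x: "x \<in> carrier N" for s x
    proof -
      obtain y where y: "y \<in> carrier R" "x = quotient_module_class R I y"
        using x unfolding N_def I.carrier_quotient_module by auto
      have "i \<otimes>\<^bsub>R\<^esub> y \<in> I"
        using I.I_r_closed[OF i y(1)] .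
      then have "i \<odot>\<^bsub>N\<^esub> x = \<zero>\<^bsub>N\<^esub>"
        unfolding N_def y(2) I.smult_quotient_module[OF iR y(1)] I.zero_quotient_module
        using iR y(1) by (simp add: I.quotient_module_class_eq_zero_iff)
      with K_diff[OF zero1[OF s] rel3[OF iR x s]] show ?thesis
        using s iR by (simp add: S.m_comm)
    qed
    then show ?thesis
      unfolding L_def using iR by auto
  qed
  ultimately have rL: "\<phi> r \<in> L"
    using S.genideal_minimal[of L "\<phi> ` I"] r(2) by auto
  define u where "u = (\<lambda>x. r \<odot>\<^bsub>N\<^esub> x)"
  have u: "u \<in> module_hom R N N"
    unfolding module_hom_def u_def using r(1)
    by (auto simp: N.smult_r_distr R.m_comm N.smult_assoc1[symmetric])
  have id: "(\<lambda>x. x) \<in> module_hom R N N"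
    unfolding module_hom_def by auto
  \<comment> \<open>Modulo the relators, the generator \<open>(r x, m)\<close> equals
    \<open>(x, \<phi> r m)\<close>, which vanishes since \<open>\<phi> r\<close> is in
    \<open>L\<close>. So \<open>u\<close> induces the zero map on the tensor product.\<close>
  have uK: "frag_extend (\<lambda>(x, m). frag_of (u x, m)) z \<in> K" if "z \<in> carrier F" for z
    using that[unfolded F]
  proof (induction z rule: frag_induction)
    case (one a)
    then obtain x m where a: "a = (x, m)" "x \<in> carrier N" "m \<in> carrier S"
      by auto
    have "frag_of (x, m \<otimes>\<^bsub>S\<^esub> \<phi> r) \<in> K"
      using rL a unfolding L_def by auto
    with K_add[OF rel3[OF r(1) a(2,3)] this] show ?case
      using a r(1) by (simp add: u_def S.m_comm)
  qed (use K_zero K_diff in \<open>auto simp: frag_extend_diff\<close>)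
  have ne: "z \<in> K #>\<^bsub>F\<^esub> z" if "z \<in> carrier F" for z
    using F.rcos_self[OF that K.subgroup_axioms] .
  have T: "carrier T = (\<lambda>z. K #>\<^bsub>F\<^esub> z) ` carrier F" "\<one>\<^bsub>T\<^esub> = K"
    unfolding T_def tensor_def F_def[symmetric] K_def[symmetric] by (simp_all add: carrier_FactGroup)
  have coset_carrier: "y \<in> carrier F" if "y \<in> K #>\<^bsub>F\<^esub> z" "z \<in> carrier F" for y z
    using subsetD[OF F.r_coset_subset_G[OF K.subset that(2)] that(1)] .
  have map_u: "tensor_map R N M u (K #>\<^bsub>F\<^esub> z) = K" if z: "z \<in> carrier F" for z
  proof -
    have "K #>\<^bsub>F\<^esub> frag_extend (\<lambda>(x, m). frag_of (u x, m)) y = K" if "y \<in> K #>\<^bsub>F\<^esub> z" for y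
      using F.coset_join2[OF _ K.subgroup_axioms uK] K.mem_carrier[OF uK] coset_carrier[OF that z]
      by blast
    then show ?thesis
      unfolding tensor_map_def F_def[symmetric] K_def[symmetric] using ne[OF z] by auto
  qed
  have map_id: "tensor_map R N M (\<lambda>x. x) (K #>\<^bsub>F\<^esub> z) = K #>\<^bsub>F\<^esub> z" if z: "z \<in> carrier F" for z
  proof -
    have "K #>\<^bsub>F\<^esub> frag_extend (\<lambda>(x, m). frag_of (x, m)) y = K #>\<^bsub>F\<^esub> z" if "y \<in> K #>\<^bsub>F\<^esub> z" for y
    proof -
      have "frag_extend (\<lambda>(x, m). frag_of (x, m)) y = frag_extend frag_of y"
        by (rule frag_extend_eq) auto
      then have "frag_extend (\<lambda>(x, m). frag_of (x, m)) y = y"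
        using frag_expansion[of y] by (rule trans[OF _ sym])
      then show ?thesis
        unfolding F.repr_independence[OF that z K.subgroup_axioms] by (rule arg_cong)
    qed
    then show ?thesis
      unfolding tensor_map_def F_def[symmetric] K_def[symmetric] using ne[OF z] by auto
  qed
  have one_T: "K \<in> carrier T"
    unfolding T using F.coset_join2[OF F.one_closed K.subgroup_axioms K.one_closed] F.one_closed by blast
  \<comment> \<open>The tensored sequence is a zero map followed by an identity: the image of the
    one and the kernel of the other both consist of the zero element, the coset
    \<open>K\<close>.\<close>
  have "tensor_map R N M u ` carrier T = {K}"
    unfolding T using map_u F.one_closed by (auto simp: image_image simp del: F)
  moreover have "kernel T T (tensor_map R N M (\<lambda>x. x)) = {K}"
  proof -
    have id: "tensor_map R N M (\<lambda>x. x) A = A" if A: "A \<in> carrier T" for A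
    proof -
      obtain z where "z \<in> carrier F" "A = K #>\<^bsub>F\<^esub> z"
        using A unfolding T(1) by (rule imageE)
      then show ?thesis
        using map_id[of z] by simp
    qed
    show ?thesis
      unfolding kernel_def T(2)
    proof (intro equalityI subsetI)
      fix A assume "A \<in> {A \<in> carrier T. tensor_map R N M (\<lambda>x. x) A = K}"
      then have "A \<in> carrier T" "tensor_map R N M (\<lambda>x. x) A = K"
        by blast+
      then show "A \<in> {K}"
        using id[of A] by simp
    qed (use one_T id[OF one_T] in simp)
  qed
  ultimately have exact: "tensor_map R N M u ` carrier (tensor R N M) =
      kernel (tensor R N M) (tensor R N M) (tensor_map R N M (\<lambda>x. x))"
    unfolding T_def by simp
  \<comment> \<open>The reflecting half of faithful flatness: exactness after tensoring implies
    exactness before.\<close>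
  note ff' = ff[folded M_def, unfolded faithfully_flat_def, THEN spec, THEN spec, THEN spec,
      THEN bspec, THEN bspec, OF u id, THEN mp, THEN iffD2, OF _ exact]
  have "u ` carrier N = a_kernel N N (\<lambda>x. x)"
    by (rule ff') (intro conjI N.module_axioms)
  \<comment> \<open>Exactness forces the image of \<open>u\<close> to be zero; at the class of 1
    this says that \<open>r\<close> is zero in \<open>R/I\<close>.\<close>
  moreover have "quotient_module_class R I \<one>\<^bsub>R\<^esub> \<in> carrier N"
    unfolding N_def I.carrier_quotient_module by (intro imageI R.one_closed)
  ultimately have "u (quotient_module_class R I \<one>\<^bsub>R\<^esub>) \<in> a_kernel N N (\<lambda>x. x)"
    by (metis imageI)
  then have "u (quotient_module_class R I \<one>\<^bsub>R\<^esub>) = \<zero>\<^bsub>N\<^esub>"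
    unfolding a_kernel_def' by simp
  then show ?thesis
    unfolding u_def N_def I.zero_quotient_module
    using r(1) by (simp add: I.smult_quotient_module I.quotient_module_class_eq_zero_iff)
qed

section \<open>Localization of domains\<close>

locale domain_localization = domain R for R (structure) +
  fixes W :: "'a set"
  assumes W_subset: "W \<subseteq> carrier R"
    and one_W [simp]: "\<one> \<in> W"
    and mult_W [simp]: "s \<in> W \<Longrightarrow> t \<in> W \<Longrightarrow> s \<otimes> t \<in> W"
    and zero_W: "\<zero> \<notin> W"
begin

abbreviation Loc :: "('a \<times> 'a) set ring" where
  "Loc \<equiv> localization R W"

abbreviation frac :: "'a \<Rightarrow> 'a \<Rightarrow> ('a \<times> 'a) set" where
  "frac \<equiv> loc_frac R W"

lemma W_carrier [simp]: "s \<in> W \<Longrightarrow> s \<in> carrier R"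
  using W_subset by auto

text \<open>The witness \<open>w\<close> is nonzero and cancels; conversely
  \<open>w = \<one>\<close> serves as one.\<close>

lemma loc_rel_iff:
  "((a, s), (b, t)) \<in> loc_rel R W \<longleftrightarrow>
    a \<in> carrier R \<and> b \<in> carrier R \<and> s \<in> W \<and> t \<in> W \<and> a \<otimes> t = b \<otimes> s"
proof -
  have "w \<otimes> (a \<otimes> t \<ominus> b \<otimes> s) = \<zero> \<longleftrightarrow> a \<otimes> t = b \<otimes> s"
    if "a \<in> carrier R" "b \<in> carrier R" "s \<in> W" "t \<in> W" "w \<in> W" for w
    using that zero_W by (auto simp: integral_iff)
  then show ?thesis
    unfolding loc_rel_def using one_W by blast
qed

lemma mem_frac_iff:
  "(b, t) \<in> frac a s \<longleftrightarrow> a \<in> carrier R \<and> b \<in> carrier R \<and> s \<in> W \<and> t \<in> W \<and> a \<otimes> t = b \<otimes> s"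
  unfolding loc_frac_def by (simp add: loc_rel_iff)

lemma equiv_loc_rel: "equiv (carrier R \<times> W) (loc_rel R W)"
proof (rule equivI)
  show "loc_rel R W \<subseteq> (carrier R \<times> W) \<times> carrier R \<times> W"
    by (auto simp: loc_rel_iff)
  show "refl_on (carrier R \<times> W) (loc_rel R W)"
    by (auto simp: refl_on_def loc_rel_iff)
  show "sym (loc_rel R W)"
    by (auto simp: sym_def loc_rel_iff)
  show "trans (loc_rel R W)"
  proof (rule transI, clarsimp simp: loc_rel_iff)
    fix a s b t c u
    assume *: "a \<in> carrier R" "b \<in> carrier R" "c \<in> carrier R" "s \<in> W" "t \<in> W" "u \<in> W"
      "a \<otimes> t = b \<otimes> s" "b \<otimes> u = c \<otimes> t"
    \<comment> \<open>Transitivity is checked after multiplying by the middle denominator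
      \<open>t\<close>, which then cancels.\<close>
    have "t \<otimes> (a \<otimes> u) = (a \<otimes> t) \<otimes> u"
      using *(1-6) by (simp add: m_ac)
    also have "\<dots> = s \<otimes> (b \<otimes> u)"
      using *(1-7) by (simp add: m_ac)
    also have "\<dots> = t \<otimes> (c \<otimes> s)"
      using *(1-6,8) by (simp add: m_ac)
    finally show "a \<otimes> u = c \<otimes> s"
      using * zero_W m_lcancel[of t "a \<otimes> u" "c \<otimes> s"] by auto
  qed
qed

lemma frac_eq_iff:
  assumes "a \<in> carrier R" "s \<in> W" "b \<in> carrier R" "t \<in> W"
  shows "frac a s = frac b t \<longleftrightarrow> a \<otimes> t = b \<otimes> s"
  unfolding loc_frac_def using eq_equiv_class_iff[OF equiv_loc_rel, of "(a, s)" "(b, t)"] assms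
  by (simp add: loc_rel_iff)

lemma frac_self: "a \<in> carrier R \<Longrightarrow> s \<in> W \<Longrightarrow> (a, s) \<in> frac a s"
  by (simp add: mem_frac_iff)

text \<open>Operations on fractions are unions over representatives. If every representative gives
  the same value \<open>c\<close>, the union collapses to \<open>c\<close>, because a fraction has
  at least one representative.\<close>

lemma UN_frac:
  assumes "a \<in> carrier R" "s \<in> W"
    and "\<And>b t. b \<in> carrier R \<Longrightarrow> t \<in> W \<Longrightarrow> a \<otimes> t = b \<otimes> s \<Longrightarrow> f b t = c"
  shows "(\<Union>(b, t)\<in>frac a s. f b t) = c"
proof -
  have "(case p of (b, t) \<Rightarrow> f b t) = c" if "p \<in> frac a s" for p
    using that assms(3) by (cases p) (simp add: mem_frac_iff)
  then have "(\<Union>(b, t)\<in>frac a s. f b t) = (\<Union>p\<in>frac a s. c)"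
    by (intro SUP_cong) auto
  also have "\<dots> = c"
    using frac_self[OF assms(1,2)] by blast
  finally show ?thesis .
qed

lemma frac_scale:
  assumes "a \<in> carrier R" "s \<in> W" "t \<in> W"
  shows "frac (a \<otimes> t) (s \<otimes> t) = frac a s"
  using assms by (simp add: frac_eq_iff m_ac)

lemma carrier_Loc: "carrier Loc = {frac a s | a s. a \<in> carrier R \<and> s \<in> W}"
  unfolding localization_def loc_frac_def by (auto simp: quotient_def)

lemma frac_closed [simp]: "a \<in> carrier R \<Longrightarrow> s \<in> W \<Longrightarrow> frac a s \<in> carrier Loc"
  unfolding carrier_Loc by blast

lemma one_Loc: "\<one>\<^bsub>Loc\<^esub> = frac \<one> \<one>"
  by (simp add: localization_def)

lemma zero_Loc: "\<zero>\<^bsub>Loc\<^esub> = frac \<zero> \<one>"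
  by (simp add: localization_def)

lemma frac_zero: "s \<in> W \<Longrightarrow> frac \<zero> s = \<zero>\<^bsub>Loc\<^esub>"
  by (simp add: zero_Loc frac_eq_iff)

lemma mult_Loc:
  assumes "a \<in> carrier R" "s \<in> W" "b \<in> carrier R" "t \<in> W"
  shows "frac a s \<otimes>\<^bsub>Loc\<^esub> frac b t = frac (a \<otimes> b) (s \<otimes> t)"
proof -
  have eq: "frac (a' \<otimes> b') (s' \<otimes> t') = frac (a \<otimes> b) (s \<otimes> t)"
    if "a' \<in> carrier R" "s' \<in> W" "a \<otimes> s' = a' \<otimes> s" "b' \<in> carrier R" "t' \<in> W" "b \<otimes> t' = b' \<otimes> t"
    for a' s' b' t'
  proof -
    have "(a' \<otimes> b') \<otimes> (s \<otimes> t) = (a' \<otimes> s) \<otimes> (b' \<otimes> t)"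
      using that(1,2,4,5) assms by (simp add: m_ac)
    also have "\<dots> = (a \<otimes> s') \<otimes> (b \<otimes> t')"
      using that by simp
    also have "\<dots> = (a \<otimes> b) \<otimes> (s' \<otimes> t')"
      using that(1,2,4,5) assms by (simp add: m_ac)
    finally show ?thesis
      using that assms by (simp add: frac_eq_iff)
  qed
  have inner: "(\<Union>(b', t')\<in>frac b t. frac (a' \<otimes> b') (s' \<otimes> t')) = frac (a \<otimes> b) (s \<otimes> t)"
    if "a' \<in> carrier R" "s' \<in> W" "a \<otimes> s' = a' \<otimes> s" for a' s'
    by (intro UN_frac assms eq that)
  have "(\<Union>(a', s')\<in>frac a s. \<Union>(b', t')\<in>frac b t. frac (a' \<otimes> b') (s' \<otimes> t')) =
      frac (a \<otimes> b) (s \<otimes> t)"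
    by (intro UN_frac assms inner)
  then show ?thesis
    by (simp add: localization_def)
qed

lemma add_Loc:
  assumes "a \<in> carrier R" "s \<in> W" "b \<in> carrier R" "t \<in> W"
  shows "frac a s \<oplus>\<^bsub>Loc\<^esub> frac b t = frac (a \<otimes> t \<oplus> b \<otimes> s) (s \<otimes> t)"
proof -
  have eq: "frac (a' \<otimes> t' \<oplus> b' \<otimes> s') (s' \<otimes> t') = frac (a \<otimes> t \<oplus> b \<otimes> s) (s \<otimes> t)"
    if "a' \<in> carrier R" "s' \<in> W" "a \<otimes> s' = a' \<otimes> s" "b' \<in> carrier R" "t' \<in> W" "b \<otimes> t' = b' \<otimes> t"
    for a' s' b' t'
  proof -
    have "(a' \<otimes> t' \<oplus> b' \<otimes> s') \<otimes> (s \<otimes> t) = (a' \<otimes> s) \<otimes> (t' \<otimes> t) \<oplus> (b' \<otimes> t) \<otimes> (s' \<otimes> s)"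
      using that(1,2,4,5) assms by (simp add: l_distr r_distr m_ac)
    also have "\<dots> = (a \<otimes> s') \<otimes> (t' \<otimes> t) \<oplus> (b \<otimes> t') \<otimes> (s' \<otimes> s)"
      using that by simp
    also have "\<dots> = (a \<otimes> t \<oplus> b \<otimes> s) \<otimes> (s' \<otimes> t')"
      using that(1,2,4,5) assms by (simp add: l_distr r_distr m_ac)
    finally show ?thesis
      using that assms by (simp add: frac_eq_iff)
  qed
  have inner: "(\<Union>(b', t')\<in>frac b t. frac (a' \<otimes> t' \<oplus> b' \<otimes> s') (s' \<otimes> t')) = frac (a \<otimes> t \<oplus> b \<otimes> s) (s \<otimes> t)"
    if "a' \<in> carrier R" "s' \<in> W" "a \<otimes> s' = a' \<otimes> s" for a' s'
    by (intro UN_frac assms eq that)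
  have "(\<Union>(a', s')\<in>frac a s. \<Union>(b', t')\<in>frac b t. frac (a' \<otimes> t' \<oplus> b' \<otimes> s') (s' \<otimes> t')) =
      frac (a \<otimes> t \<oplus> b \<otimes> s) (s \<otimes> t)"
    by (intro UN_frac assms inner)
  then show ?thesis
    by (simp add: localization_def)
qed

text \<open>Over a common denominator addition acts on numerators alone, which reduces the additive
  axioms of \<open>Loc\<close> to those of \<open>R\<close>.\<close>

lemma add_Loc_same:
  assumes "a \<in> carrier R" "b \<in> carrier R" "t \<in> W"
  shows "frac a t \<oplus>\<^bsub>Loc\<^esub> frac b t = frac (a \<oplus> b) t"
proof -
  have "frac a t \<oplus>\<^bsub>Loc\<^esub> frac b t = frac ((a \<oplus> b) \<otimes> t) (t \<otimes> t)"
    using assms by (simp add: add_Loc l_distr)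
  also have "\<dots> = frac (a \<oplus> b) t"
    using assms by (intro frac_scale) auto
  finally show ?thesis .
qed

lemma common_denominator:
  assumes "x \<in> carrier Loc" "y \<in> carrier Loc"
  obtains a b t where "a \<in> carrier R" "b \<in> carrier R" "t \<in> W" "x = frac a t" "y = frac b t"
proof -
  obtain a s b t where *: "a \<in> carrier R" "s \<in> W" "x = frac a s" "b \<in> carrier R" "t \<in> W" "y = frac b t"
    using assms unfolding carrier_Loc by auto
  then have "x = frac (a \<otimes> t) (s \<otimes> t)" "y = frac (b \<otimes> s) (s \<otimes> t)"
    using frac_scale[of b t s] by (auto simp: frac_scale m_comm)
  then show thesis
    using * by (intro that[of "a \<otimes> t" "b \<otimes> s" "s \<otimes> t"]) auto
qed

lemma common_denominator3:
  assumes "x \<in> carrier Loc" "y \<in> carrier Loc" "z \<in> carrier Loc"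
  obtains a b c t where "a \<in> carrier R" "b \<in> carrier R" "c \<in> carrier R" "t \<in> W"
    "x = frac a t" "y = frac b t" "z = frac c t"
proof -
  obtain a b s where *: "a \<in> carrier R" "b \<in> carrier R" "s \<in> W" "x = frac a s" "y = frac b s"
    using common_denominator[OF assms(1,2)] .
  obtain c t where **: "c \<in> carrier R" "t \<in> W" "z = frac c t"
    using assms(3) unfolding carrier_Loc by auto
  have "x = frac (a \<otimes> t) (s \<otimes> t)" "y = frac (b \<otimes> t) (s \<otimes> t)" "z = frac (c \<otimes> s) (s \<otimes> t)"
    using * ** frac_scale[of c t s] by (auto simp: frac_scale m_comm)
  then show thesis
    using * ** by (intro that[of "a \<otimes> t" "b \<otimes> t" "c \<otimes> s" "s \<otimes> t"]) auto
qed

lemma cring_Loc: "cring Loc"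
proof (rule cringI)
  show "abelian_group Loc"
  proof (rule abelian_groupI)
    fix x y z assume "x \<in> carrier Loc" "y \<in> carrier Loc" "z \<in> carrier Loc"
    from common_denominator3[OF this] obtain a b c t where
      *: "a \<in> carrier R" "b \<in> carrier R" "c \<in> carrier R" "t \<in> W"
      "x = frac a t" "y = frac b t" "z = frac c t" .
    then show "x \<oplus>\<^bsub>Loc\<^esub> y \<oplus>\<^bsub>Loc\<^esub> z = x \<oplus>\<^bsub>Loc\<^esub> (y \<oplus>\<^bsub>Loc\<^esub> z)"
      by (simp add: add_Loc_same a_assoc)
  next
    fix x y assume xy: "x \<in> carrier Loc" "y \<in> carrier Loc"
    obtain a b t where *: "a \<in> carrier R" "b \<in> carrier R" "t \<in> W" "x = frac a t" "y = frac b t"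
      using common_denominator[OF xy] .
    then show "x \<oplus>\<^bsub>Loc\<^esub> y \<in> carrier Loc" "x \<oplus>\<^bsub>Loc\<^esub> y = y \<oplus>\<^bsub>Loc\<^esub> x"
      by (simp_all add: add_Loc_same a_comm)
  next
    fix x assume "x \<in> carrier Loc"
    then obtain a t where *: "a \<in> carrier R" "t \<in> W" "x = frac a t"
      unfolding carrier_Loc by auto
    then show "\<zero>\<^bsub>Loc\<^esub> \<oplus>\<^bsub>Loc\<^esub> x = x"
      by (simp add: add_Loc_same flip: frac_zero[of t])
    show "\<exists>y\<in>carrier Loc. y \<oplus>\<^bsub>Loc\<^esub> x = \<zero>\<^bsub>Loc\<^esub>"
      using * by (intro bexI[of _ "frac (\<ominus> a) t"]) (auto simp: add_Loc_same l_neg frac_zero)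
  qed (simp add: zero_Loc)
  show "comm_monoid Loc"
  proof (rule comm_monoidI)
    fix x y assume "x \<in> carrier Loc" "y \<in> carrier Loc"
    then obtain a s b t where *: "a \<in> carrier R" "s \<in> W" "x = frac a s" "b \<in> carrier R" "t \<in> W" "y = frac b t"
      unfolding carrier_Loc by auto
    then show "x \<otimes>\<^bsub>Loc\<^esub> y \<in> carrier Loc" "x \<otimes>\<^bsub>Loc\<^esub> y = y \<otimes>\<^bsub>Loc\<^esub> x"
      by (simp_all add: mult_Loc m_comm)
    fix z assume "z \<in> carrier Loc"
    then obtain c u where "c \<in> carrier R" "u \<in> W" "z = frac c u"
      unfolding carrier_Loc by auto
    with * show "x \<otimes>\<^bsub>Loc\<^esub> y \<otimes>\<^bsub>Loc\<^esub> z = x \<otimes>\<^bsub>Loc\<^esub> (y \<otimes>\<^bsub>Loc\<^esub> z)"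
      by (simp add: mult_Loc m_assoc)
  next
    show "\<one>\<^bsub>Loc\<^esub> \<in> carrier Loc"
      by (simp add: one_Loc)
    fix x assume "x \<in> carrier Loc"
    then obtain a s where "a \<in> carrier R" "s \<in> W" "x = frac a s"
      unfolding carrier_Loc by auto
    then show "\<one>\<^bsub>Loc\<^esub> \<otimes>\<^bsub>Loc\<^esub> x = x"
      by (simp add: one_Loc mult_Loc)
  qed
  fix x y z assume xyz: "x \<in> carrier Loc" "y \<in> carrier Loc" "z \<in> carrier Loc"
  obtain a b t where *: "a \<in> carrier R" "b \<in> carrier R" "t \<in> W" "x = frac a t" "y = frac b t"
    using common_denominator[OF xyz(1,2)] .
  obtain c u where "c \<in> carrier R" "u \<in> W" "z = frac c u"
    using xyz(3) unfolding carrier_Loc by auto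
  with * show "(x \<oplus>\<^bsub>Loc\<^esub> y) \<otimes>\<^bsub>Loc\<^esub> z = x \<otimes>\<^bsub>Loc\<^esub> z \<oplus>\<^bsub>Loc\<^esub> y \<otimes>\<^bsub>Loc\<^esub> z"
    by (simp add: mult_Loc add_Loc_same l_distr)
qed

end

section \<open>The induced map of localizations\<close>

lemma (in domain_localization) loc_map_frac:
  assumes "domain_localization S (\<phi> ` W)" and \<phi>: "\<phi> \<in> ring_hom R S"
    and "a \<in> carrier R" "s \<in> W"
  shows "loc_map S W \<phi> (frac a s) = loc_frac S (\<phi> ` W) (\<phi> a) (\<phi> s)"
proof -
  interpret S: domain_localization S "\<phi> ` W" by fact
  have eq: "loc_frac S (\<phi> ` W) (\<phi> b) (\<phi> t) = loc_frac S (\<phi> ` W) (\<phi> a) (\<phi> s)"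
    if "b \<in> carrier R" "t \<in> W" "a \<otimes> t = b \<otimes> s" for b t
  proof -
    have "\<phi> a \<otimes>\<^bsub>S\<^esub> \<phi> t = \<phi> b \<otimes>\<^bsub>S\<^esub> \<phi> s"
      using that assms(3,4) by (simp flip: ring_hom_mult[OF \<phi>])
    then show ?thesis
      using that assms(3,4) ring_hom_closed[OF \<phi>] by (simp add: S.frac_eq_iff)
  qed
  then show ?thesis
    unfolding loc_map_def by (intro UN_frac assms(3,4) eq)
qed

lemma (in domain_localization) loc_map_hom:
  assumes "domain_localization S (\<phi> ` W)" and \<phi>: "\<phi> \<in> ring_hom R S"
  shows "loc_map S W \<phi> \<in> ring_hom Loc (localization S (\<phi> ` W))"
proof -
  interpret S: domain_localization S "\<phi> ` W" by fact
  note simps = loc_map_frac[OF assms] ring_hom_closed[OF \<phi>] ring_hom_mult[OF \<phi>]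
    ring_hom_add[OF \<phi>] ring_hom_one[OF \<phi>]
  show ?thesis
  proof (rule ring_hom_memI)
    fix x assume x: "x \<in> carrier Loc"
    then obtain a s where x': "a \<in> carrier R" "s \<in> W" "x = frac a s"
      unfolding carrier_Loc by auto
    then show "loc_map S W \<phi> x \<in> carrier S.Loc"
      by (simp add: simps)
    fix y assume y: "y \<in> carrier Loc"
    then obtain b t where "b \<in> carrier R" "t \<in> W" "y = frac b t"
      unfolding carrier_Loc by auto
    with x' show "loc_map S W \<phi> (x \<otimes>\<^bsub>Loc\<^esub> y) = loc_map S W \<phi> x \<otimes>\<^bsub>S.Loc\<^esub> loc_map S W \<phi> y"
      by (simp add: simps mult_Loc S.mult_Loc)
    obtain a b t where "a \<in> carrier R" "b \<in> carrier R" "t \<in> W" "x = frac a t" "y = frac b t"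
      using common_denominator[OF x y] .
    then show "loc_map S W \<phi> (x \<oplus>\<^bsub>Loc\<^esub> y) = loc_map S W \<phi> x \<oplus>\<^bsub>S.Loc\<^esub> loc_map S W \<phi> y"
      by (simp add: simps add_Loc_same S.add_Loc_same)
  qed (simp add: one_Loc S.one_Loc simps)
qed

section \<open>Finiteness of the maximal ideals containing an element\<close>

text \<open>The union \<open>U\<close> is an ideal since any two members of the family lie in a
  third. Each of its finitely many generators already lies in some \<open>J F\<close>, and
  \<open>F0\<close> is the union of the finite index sets so obtained.\<close>

lemma (in noetherian_domain) directed_ideals_stabilize:
  assumes J: "\<And>F. finite F \<Longrightarrow> F \<subseteq> T \<Longrightarrow> ideal (J F) R"
    and mono: "\<And>F G. finite G \<Longrightarrow> G \<subseteq> T \<Longrightarrow> F \<subseteq> G \<Longrightarrow> J F \<subseteq> J G"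
  obtains F0 where "finite F0" "F0 \<subseteq> T" "\<And>F. finite F \<Longrightarrow> F \<subseteq> T \<Longrightarrow> J F \<subseteq> J F0"
proof -
  define U where "U = (\<Union>F\<in>{F. finite F \<and> F \<subseteq> T}. J F)"
  have sub: "J F \<subseteq> U" if "finite F" "F \<subseteq> T" for F
    unfolding U_def using that by blast
  have U_E: "\<exists>F. finite F \<and> F \<subseteq> T \<and> x \<in> J F" if "x \<in> U" for x
    using that unfolding U_def by blast
  have "ideal U R"
  proof (rule idealI_closed)
    show "U \<subseteq> carrier R"
      using U_E ideal.Icarr[OF J] by blast
    show "\<zero> \<in> U"
      using sub[of "{}"] additive_subgroup.zero_closed[OF ideal.axioms(1)[OF J[of "{}"]]] by auto
    show "r \<otimes> x \<in> U" if "r \<in> carrier R" "x \<in> U" for r x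
      using U_E[OF that(2)] ideal.I_l_closed[OF J _ that(1)] sub by blast
    fix x y assume "x \<in> U" "y \<in> U"
    then obtain F G where F: "finite F" "F \<subseteq> T" "x \<in> J F" and G: "finite G" "G \<subseteq> T" "y \<in> J G"
      using U_E by meson
    have FG: "finite (F \<union> G)" "F \<union> G \<subseteq> T"
      using F G by auto
    have "x \<in> J (F \<union> G)" "y \<in> J (F \<union> G)"
      using mono[OF FG, of F] mono[OF FG, of G] F(3) G(3) by auto
    then have "x \<oplus> y \<in> J (F \<union> G)"
      by (rule additive_subgroup.a_closed[OF ideal.axioms(1)[OF J[OF FG]]])
    then show "x \<oplus> y \<in> U"
      using sub[OF FG] by auto
  qed
  then obtain A where A: "A \<subseteq> carrier R" "finite A" "U = Idl A"
    using finetely_gen by auto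
  have "\<forall>x\<in>A. \<exists>F. finite F \<and> F \<subseteq> T \<and> x \<in> J F"
    using U_E genideal_self[OF A(1)] A(3) by auto
  then obtain F where F: "\<And>x. x \<in> A \<Longrightarrow> finite (F x) \<and> F x \<subseteq> T \<and> x \<in> J (F x)"
    by metis
  define F0 where "F0 = (\<Union>x\<in>A. F x)"
  have F0: "finite F0" "F0 \<subseteq> T"
    unfolding F0_def using F A(2) by auto
  have "A \<subseteq> J F0"
  proof
    fix x assume x: "x \<in> A"
    have "F x \<subseteq> F0"
      unfolding F0_def using x by auto
    from mono[OF F0 this] show "x \<in> J F0"
      using F[OF x] by auto
  qed
  then have "U \<subseteq> J F0"
    unfolding A(3) using genideal_minimal[OF J[OF F0]] by simp
  then show thesis
    using that[OF F0] sub by blast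
qed

text \<open>Choose an element of each \<open>Q M\<close> outside \<open>N\<close>. The product lies
  in every \<open>Q M\<close>, and outside \<open>N\<close> because \<open>N\<close> is
  prime.\<close>

lemma (in cring) avoid_maximal:
  assumes N: "maximalideal N R" and "finite T"
    and Q: "\<And>M. M \<in> T \<Longrightarrow> ideal (Q M) R" "\<And>M. M \<in> T \<Longrightarrow> \<not> Q M \<subseteq> N"
  shows "\<exists>t\<in>carrier R - N. \<forall>M\<in>T. t \<in> Q M"
  using assms(2-4)
proof (induction T)
  case empty
  then show ?case
    using maximal_compl_one[OF N] by auto
next
  case (insert M T)
  then obtain t where t: "t \<in> carrier R - N" "\<forall>L\<in>T. t \<in> Q L"
    by auto
  obtain q where q: "q \<in> Q M" "q \<notin> N"
    using insert.prems(2)[of M] by auto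
  interpret M: ideal "Q M" R
    using insert.prems(1) by simp
  have "q \<in> carrier R - N"
    using q M.Icarr by auto
  then have "t \<otimes> q \<in> carrier R - N"
    using maximal_compl_mult[OF N t(1)] by auto
  moreover have "t \<otimes> q \<in> Q M"
    using M.I_l_closed q t by auto
  moreover have "t \<otimes> q \<in> Q L" if "L \<in> T" for L
    using ideal.I_r_closed[OF insert.prems(1)[of L]] that t \<open>q \<in> carrier R - N\<close> by auto
  ultimately show ?case
    by blast
qed

text \<open>\<open>pure\<close> says that the map from \<open>R/I\<close> to \<open>S/IS\<close> is
  injective for every ideal \<open>I\<close>; this is known as cyclic purity.\<close>

locale cyclically_pure_extension = R?: domain R + S?: noetherian_domain S
  for R (structure) and S (structure) +
  fixes \<phi> :: "'a \<Rightarrow> 'c"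
  assumes hom: "\<phi> \<in> ring_hom R S"
    and pure: "ideal I R \<Longrightarrow> r \<in> carrier R \<Longrightarrow> \<phi> r \<in> Idl\<^bsub>S\<^esub> (\<phi> ` I) \<Longrightarrow> r \<in> I"
begin

section \<open>Extension and contraction of ideals along the ring homomorphism\<close>

lemma hom_closed [simp]: "r \<in> carrier R \<Longrightarrow> \<phi> r \<in> carrier S"
  using ring_hom_closed[OF hom] .

lemma hom_mult: "r \<in> carrier R \<Longrightarrow> s \<in> carrier R \<Longrightarrow> \<phi> (r \<otimes>\<^bsub>R\<^esub> s) = \<phi> r \<otimes>\<^bsub>S\<^esub> \<phi> s"
  using ring_hom_mult[OF hom] .

lemma image_carrier: "I \<subseteq> carrier R \<Longrightarrow> \<phi> ` I \<subseteq> carrier S"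
  by auto

lemma extension_ideal: "I \<subseteq> carrier R \<Longrightarrow> ideal (Idl\<^bsub>S\<^esub> (\<phi> ` I)) S"
  by (intro S.genideal_ideal image_carrier)

lemma extension_mem: "I \<subseteq> carrier R \<Longrightarrow> i \<in> I \<Longrightarrow> \<phi> i \<in> Idl\<^bsub>S\<^esub> (\<phi> ` I)"
  using S.genideal_self[OF image_carrier] by auto

lemma extension_mono: "J \<subseteq> carrier R \<Longrightarrow> I \<subseteq> J \<Longrightarrow> Idl\<^bsub>S\<^esub> (\<phi> ` I) \<subseteq> Idl\<^bsub>S\<^esub> (\<phi> ` J)"
  by (intro S.subset_Idl_subset image_carrier image_mono)

lemma hom_zero: "\<phi> \<zero>\<^bsub>R\<^esub> = \<zero>\<^bsub>S\<^esub>"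
  using ring_hom_zero[OF hom R.ring_axioms S.ring_axioms] .

lemma extension_zero: "Idl\<^bsub>S\<^esub> (\<phi> ` {\<zero>\<^bsub>R\<^esub>}) = {\<zero>\<^bsub>S\<^esub>}"
  by (simp add: hom_zero S.genideal_zero)

text \<open>Purity for the zero ideal makes \<open>\<phi>\<close> injective.\<close>

lemma hom_eq_zero_iff: "r \<in> carrier R \<Longrightarrow> \<phi> r = \<zero>\<^bsub>S\<^esub> \<longleftrightarrow> r = \<zero>\<^bsub>R\<^esub>"
  using pure[OF R.zeroideal, of r] hom_zero extension_zero by auto

text \<open>Divisibility descends from \<open>S\<close> to \<open>R\<close>: a fraction of elements
  of \<open>R\<close> that lies in \<open>S\<close> lies in \<open>R\<close>.\<close>

lemma pure_principal:
  assumes "a \<in> carrier R" "r \<in> carrier R" "\<phi> r \<in> PIdl\<^bsub>S\<^esub> (\<phi> a)"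
  shows "r \<in> PIdl\<^bsub>R\<^esub> a"
proof -
  have a: "ideal (PIdl\<^bsub>R\<^esub> a) R" "a \<in> PIdl\<^bsub>R\<^esub> a" "PIdl\<^bsub>R\<^esub> a \<subseteq> carrier R"
    using R.cgenideal_ideal R.cgenideal_self assms(1) ideal.Icarr[OF R.cgenideal_ideal[OF assms(1)]]
    by auto
  have "\<phi> a \<in> Idl\<^bsub>S\<^esub> (\<phi> ` (PIdl\<^bsub>R\<^esub> a))"
    using extension_mem[OF a(3,2)] .
  then have "PIdl\<^bsub>S\<^esub> (\<phi> a) \<subseteq> Idl\<^bsub>S\<^esub> (\<phi> ` (PIdl\<^bsub>R\<^esub> a))"
    using S.cgenideal_minimal[OF extension_ideal[OF a(3)]] by auto
  then show ?thesis
    using pure[OF a(1) assms(2)] assms(3) by auto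
qed

text \<open>\<open>R\<close> inherits the Noetherian property. The extension of \<open>M\<close> to
  \<open>S\<close> is already generated by the images of a finite subset \<open>A\<close> of
  \<open>M\<close>, and contracting back to \<open>R\<close> puts \<open>M\<close> into the ideal
  generated by \<open>A\<close>.\<close>

lemma ideal_finitely_generated:
  assumes M: "ideal M R"
  shows "\<exists>A. finite A \<and> A \<subseteq> M \<and> M \<subseteq> Idl\<^bsub>R\<^esub> A"
proof -
  have MR: "M \<subseteq> carrier R"
    using ideal.Icarr[OF M] by auto
  obtain A where A: "finite A" "A \<subseteq> M"
    "\<And>F. finite F \<Longrightarrow> F \<subseteq> M \<Longrightarrow> Idl\<^bsub>S\<^esub> (\<phi> ` F) \<subseteq> Idl\<^bsub>S\<^esub> (\<phi> ` A)"
  proof (rule S.directed_ideals_stabilize[of M "\<lambda>F. Idl\<^bsub>S\<^esub> (\<phi> ` F)"])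
    show "ideal (Idl\<^bsub>S\<^esub> (\<phi> ` F)) S" if "F \<subseteq> M" for F
      using extension_ideal that MR by blast
    show "Idl\<^bsub>S\<^esub> (\<phi> ` F) \<subseteq> Idl\<^bsub>S\<^esub> (\<phi> ` G)" if "G \<subseteq> M" "F \<subseteq> G" for F G
      using extension_mono[OF _ that(2)] that(1) MR by blast
  qed blast
  have AR: "A \<subseteq> carrier R"
    using A MR by auto
  have IA: "ideal (Idl\<^bsub>R\<^esub> A) R" "A \<subseteq> Idl\<^bsub>R\<^esub> A"
    using R.genideal_ideal[OF AR] R.genideal_self[OF AR] .
  have "y \<in> Idl\<^bsub>R\<^esub> A" if y: "y \<in> M" for y
  proof (rule pure[OF IA(1)])
    show "y \<in> carrier R"
      using y MR by auto
    then have "\<phi> y \<in> Idl\<^bsub>S\<^esub> (\<phi> ` {y})"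
      by (intro extension_mem) auto
    then have "\<phi> y \<in> Idl\<^bsub>S\<^esub> (\<phi> ` A)"
      using A(3)[of "{y}"] y by auto
    moreover have "Idl\<^bsub>R\<^esub> A \<subseteq> carrier R"
      using ideal.Icarr[OF IA(1)] by auto
    ultimately show "\<phi> y \<in> Idl\<^bsub>S\<^esub> (\<phi> ` (Idl\<^bsub>R\<^esub> A))"
      using extension_mono[OF _ IA(2)] by auto
  qed
  with A show ?thesis
    by auto
qed

text \<open>The fraction \<open>b/a\<close> lies in the inverse of \<open>M\<close> but not in \<open>R\<close>, and \<open>g = f b/a\<close>.\<close>

lemma inverse_witness:
  assumes dim: "krull_dim R \<le> 1" and M: "maximalideal M R"
    and f: "f \<in> carrier S" "f \<noteq> \<zero>\<^bsub>S\<^esub>" "f \<in> Idl\<^bsub>S\<^esub> (\<phi> ` M)"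
  shows "\<exists>a\<in>carrier R - {\<zero>\<^bsub>R\<^esub>}. \<exists>b\<in>carrier R - PIdl\<^bsub>R\<^esub> a. \<exists>g\<in>carrier S.
    (\<forall>y\<in>M. b \<otimes>\<^bsub>R\<^esub> y \<in> PIdl\<^bsub>R\<^esub> a) \<and> \<phi> b \<otimes>\<^bsub>S\<^esub> f = g \<otimes>\<^bsub>S\<^esub> \<phi> a"
proof -
  interpret M: maximalideal M R by fact
  \<comment> \<open>If \<open>M\<close> were zero, its extension would be zero as well, and
    \<open>f\<close> with it.\<close>
  have "M \<noteq> {\<zero>\<^bsub>R\<^esub>}"
    using f(2,3) by (metis extension_zero singletonD)
  then obtain a where a: "a \<in> M" "a \<noteq> \<zero>\<^bsub>R\<^esub>"
    using additive_subgroup.zero_closed[OF M.is_additive_subgroup] by blast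
  have aR: "a \<in> carrier R"
    using a M.Icarr by auto
  have "PIdl\<^bsub>R\<^esub> a \<noteq> {\<zero>\<^bsub>R\<^esub>}" "PIdl\<^bsub>R\<^esub> a \<subseteq> M"
    using a R.cgenideal_self[OF aR] R.cgenideal_minimal[OF M.is_ideal] by auto
  moreover obtain A where "finite A" "A \<subseteq> M" "M \<subseteq> Idl\<^bsub>R\<^esub> A"
    using ideal_finitely_generated[OF M.is_ideal] by auto
  ultimately obtain b where b: "b \<in> carrier R - PIdl\<^bsub>R\<^esub> a" "\<And>y. y \<in> M \<Longrightarrow> b \<otimes>\<^bsub>R\<^esub> y \<in> PIdl\<^bsub>R\<^esub> a"
    using R.maximal_ideal_annihilates_modulo[OF dim M R.cgenideal_ideal[OF aR]] by meson
  \<comment> \<open>Since \<open>b M\<close> lies in \<open>a R\<close>, multiplication by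
    \<open>\<phi> b\<close> takes \<open>MS\<close> into \<open>aS\<close>. Hence
    \<open>f b/a\<close> is an element of \<open>S\<close>.\<close>
  have "\<phi> b \<otimes>\<^bsub>S\<^esub> f \<in> PIdl\<^bsub>S\<^esub> (\<phi> a)"
  proof (rule S.mult_genideal[OF S.cgenideal_ideal _ image_carrier _ f(3)])
    fix z assume "z \<in> \<phi> ` M"
    then obtain y where y: "y \<in> M" "z = \<phi> y"
      by auto
    obtain c where c: "c \<in> carrier R" "b \<otimes>\<^bsub>R\<^esub> y = c \<otimes>\<^bsub>R\<^esub> a"
      using b(2)[OF y(1)] unfolding cgenideal_def by auto
    have "\<phi> b \<otimes>\<^bsub>S\<^esub> z = \<phi> c \<otimes>\<^bsub>S\<^esub> \<phi> a"
      using hom_mult[of b y] hom_mult[OF c(1) aR] b(1) y M.Icarr[OF y(1)] c(2) by auto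
    then show "\<phi> b \<otimes>\<^bsub>S\<^esub> z \<in> PIdl\<^bsub>S\<^esub> (\<phi> a)"
      unfolding cgenideal_def using hom_closed[OF c(1)] by blast
  qed (use aR b M.Icarr in auto)
  then obtain g where "g \<in> carrier S" "\<phi> b \<otimes>\<^bsub>S\<^esub> f = g \<otimes>\<^bsub>S\<^esub> \<phi> a"
    unfolding cgenideal_def by auto
  with a aR b show ?thesis
    by blast
qed

text \<open>If infinitely many maximal ideals occurred, the ideals of \<open>S\<close> generated by the elements
  \<open>f b/a\<close> would form an ascending chain that does not stabilize.\<close>

lemma finite_maximal_ideals_of_element:
  assumes dim: "krull_dim R \<le> 1" and f: "f \<in> carrier S" "f \<noteq> \<zero>\<^bsub>S\<^esub>"
  shows "finite {M. maximalideal M R \<and> f \<in> Idl\<^bsub>S\<^esub> (\<phi> ` M)}" (is "finite ?T")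
proof (rule ccontr)
  assume inf: "infinite ?T"
  \<comment> \<open>\<open>J F\<close> is the colon ideal of \<open>fS\<close> by the intersection
    of the members of \<open>F\<close>; it grows with \<open>F\<close>.\<close>
  define J where "J F = {x \<in> carrier S. \<forall>d\<in>carrier R. (\<forall>M\<in>F. d \<in> M) \<longrightarrow> \<phi> d \<otimes>\<^bsub>S\<^esub> x \<in> PIdl\<^bsub>S\<^esub> f}"
    for F
  have If: "ideal (PIdl\<^bsub>S\<^esub> f) S"
    using S.cgenideal_ideal[OF f(1)] .
  interpret If: ideal "PIdl\<^bsub>S\<^esub> f" S by fact
  have ideal_J: "ideal (J F) S" for F
  proof (rule S.idealI_closed)
    show "\<zero>\<^bsub>S\<^esub> \<in> J F"
      unfolding J_def by (simp add: additive_subgroup.zero_closed[OF If.is_additive_subgroup])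
    show "x \<oplus>\<^bsub>S\<^esub> y \<in> J F" if "x \<in> J F" "y \<in> J F" for x y
      using that unfolding J_def
      by (auto simp: S.r_distr intro!: additive_subgroup.a_closed[OF If.is_additive_subgroup])
    show "r \<otimes>\<^bsub>S\<^esub> x \<in> J F" if "r \<in> carrier S" "x \<in> J F" for r x
    proof -
      have "\<phi> d \<otimes>\<^bsub>S\<^esub> (r \<otimes>\<^bsub>S\<^esub> x) \<in> PIdl\<^bsub>S\<^esub> f" if d: "d \<in> carrier R" "\<forall>M\<in>F. d \<in> M" for d
      proof -
        have x: "x \<in> carrier S" "\<phi> d \<otimes>\<^bsub>S\<^esub> x \<in> PIdl\<^bsub>S\<^esub> f"
          using \<open>x \<in> J F\<close> d unfolding J_def by auto
        then show ?thesis
          using If.I_l_closed[OF x(2) \<open>r \<in> carrier S\<close>] d \<open>r \<in> carrier S\<close> by (simp add: S.m_lcomm)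
      qed
      with that show ?thesis
        unfolding J_def by auto
    qed
  qed (auto simp: J_def)
  have mono_J: "J F \<subseteq> J G" if "F \<subseteq> G" for F G
    using that unfolding J_def by blast
  obtain F where F: "finite F" "F \<subseteq> ?T" "\<And>G. finite G \<Longrightarrow> G \<subseteq> ?T \<Longrightarrow> J G \<subseteq> J F"
  proof (rule S.directed_ideals_stabilize[of ?T J])
    show "J F \<subseteq> J G" if "F \<subseteq> G" for F G
      using mono_J[OF that] .
  qed (auto intro: ideal_J)
  obtain N where N: "N \<in> ?T" "N \<notin> F"
    using inf F(1,2) by (metis (no_types, lifting) finite_subset subsetI)
  then interpret N: maximalideal N R
    by simp
  obtain a b g where a: "a \<in> carrier R" "a \<noteq> \<zero>\<^bsub>R\<^esub>" and b: "b \<in> carrier R" "b \<notin> PIdl\<^bsub>R\<^esub> a"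
    and g: "g \<in> carrier S" "\<phi> b \<otimes>\<^bsub>S\<^esub> f = g \<otimes>\<^bsub>S\<^esub> \<phi> a"
    and b_mult: "\<And>y. y \<in> N \<Longrightarrow> b \<otimes>\<^bsub>R\<^esub> y \<in> PIdl\<^bsub>R\<^esub> a"
    using inverse_witness[OF dim N.is_maximalideal f] N(1) by blast
  \<comment> \<open>For \<open>d\<close> in \<open>N\<close> the fraction \<open>d b/a\<close> is an
    element \<open>c\<close> of \<open>R\<close>. As \<open>g\<close> is \<open>f b/a\<close>,
    cancelling \<open>\<phi> a\<close> gives \<open>d g = c f\<close>.\<close>
  have "g \<in> J {N}"
    unfolding J_def
  proof (intro CollectI conjI ballI impI g(1))
    fix d assume "d \<in> carrier R" "\<forall>M\<in>{N}. d \<in> M"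
    then have d: "d \<in> carrier R" "d \<in> N"
      by auto
    obtain c where c: "c \<in> carrier R" "b \<otimes>\<^bsub>R\<^esub> d = c \<otimes>\<^bsub>R\<^esub> a"
      using b_mult[OF d(2)] unfolding cgenideal_def by auto
    have "\<phi> a \<otimes>\<^bsub>S\<^esub> (\<phi> d \<otimes>\<^bsub>S\<^esub> g) = \<phi> d \<otimes>\<^bsub>S\<^esub> (g \<otimes>\<^bsub>S\<^esub> \<phi> a)"
      using a d g(1) by (simp add: S.m_ac)
    also have "\<dots> = (\<phi> b \<otimes>\<^bsub>S\<^esub> \<phi> d) \<otimes>\<^bsub>S\<^esub> f"
      unfolding g(2)[symmetric] using b d f by (simp add: S.m_ac)
    also have "\<dots> = (\<phi> c \<otimes>\<^bsub>S\<^esub> \<phi> a) \<otimes>\<^bsub>S\<^esub> f"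
      using hom_mult[OF b(1) d(1)] hom_mult[OF c(1) a(1)] c(2) by simp
    also have "\<dots> = \<phi> a \<otimes>\<^bsub>S\<^esub> (\<phi> c \<otimes>\<^bsub>S\<^esub> f)"
      using a c(1) f by (simp add: S.m_ac)
    finally have "\<phi> d \<otimes>\<^bsub>S\<^esub> g = \<phi> c \<otimes>\<^bsub>S\<^esub> f"
      using S.m_lcancel[of "\<phi> a" "\<phi> d \<otimes>\<^bsub>S\<^esub> g" "\<phi> c \<otimes>\<^bsub>S\<^esub> f"] a c(1) d f(1) g(1) hom_eq_zero_iff by simp
    then show "\<phi> d \<otimes>\<^bsub>S\<^esub> g \<in> PIdl\<^bsub>S\<^esub> f"
      unfolding cgenideal_def using hom_closed[OF c(1)] by blast
  qed
  then have gF: "g \<in> J F"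
    using F(3)[of "{N}"] N by auto
  \<comment> \<open>Since \<open>N\<close> is not in \<open>F\<close>, some \<open>d\<close> outside
    \<open>N\<close> lies in all members of \<open>F\<close>. As \<open>g\<close> is in
    \<open>J F\<close>, the product \<open>d g\<close> is a multiple of \<open>f\<close>.\<close>
  have "\<exists>d\<in>carrier R - N. \<forall>M\<in>F. d \<in> M"
  proof (rule R.avoid_maximal[OF N.is_maximalideal F(1)])
    fix M assume M: "M \<in> F"
    then have "maximalideal M R"
      using F(2) by auto
    then show "ideal M R" "\<not> M \<subseteq> N"
      using R.maximal_not_subset[OF _ N.is_maximalideal] M N(2) maximalideal.axioms(1) by auto
  qed
  then obtain d where d: "d \<in> carrier R" "d \<notin> N" "\<And>M. M \<in> F \<Longrightarrow> d \<in> M"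
    by auto
  then obtain h where h: "h \<in> carrier S" "\<phi> d \<otimes>\<^bsub>S\<^esub> g = h \<otimes>\<^bsub>S\<^esub> f"
    using gF unfolding J_def cgenideal_def by auto
  \<comment> \<open>Cancelling \<open>f\<close> leaves \<open>d b/a = h\<close> in \<open>S\<close>,
    and then \<open>d b/a\<close> is in \<open>R\<close> by purity.\<close>
  have "f \<otimes>\<^bsub>S\<^esub> (\<phi> b \<otimes>\<^bsub>S\<^esub> \<phi> d) = \<phi> d \<otimes>\<^bsub>S\<^esub> (\<phi> b \<otimes>\<^bsub>S\<^esub> f)"
    using b d f by (simp add: S.m_ac)
  also have "\<dots> = \<phi> a \<otimes>\<^bsub>S\<^esub> (\<phi> d \<otimes>\<^bsub>S\<^esub> g)"
    unfolding g(2) using a d g(1) by (simp add: S.m_ac)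
  also have "\<dots> = f \<otimes>\<^bsub>S\<^esub> (h \<otimes>\<^bsub>S\<^esub> \<phi> a)"
    unfolding h(2) using a h(1) f by (simp add: S.m_ac)
  finally have "\<phi> b \<otimes>\<^bsub>S\<^esub> \<phi> d = h \<otimes>\<^bsub>S\<^esub> \<phi> a"
    using S.m_lcancel[OF f(2,1), of "\<phi> b \<otimes>\<^bsub>S\<^esub> \<phi> d" "h \<otimes>\<^bsub>S\<^esub> \<phi> a"] a b d h(1) by simp
  then have "\<phi> (b \<otimes>\<^bsub>R\<^esub> d) \<in> PIdl\<^bsub>S\<^esub> (\<phi> a)"
    unfolding cgenideal_def hom_mult[OF b(1) d(1)] using h(1) by blast
  then have bd: "b \<otimes>\<^bsub>R\<^esub> d \<in> PIdl\<^bsub>R\<^esub> a"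
    using pure_principal[OF a(1)] b d by simp
  \<comment> \<open>The elements that multiply \<open>b/a\<close> into \<open>R\<close> form an
    ideal containing \<open>N\<close> and \<open>d\<close>, hence all of \<open>R\<close>. But 1
    cannot be among them, because \<open>b\<close> is not a multiple of \<open>a\<close>.\<close>
  define C where "C = {r \<in> carrier R. b \<otimes>\<^bsub>R\<^esub> r \<in> PIdl\<^bsub>R\<^esub> a}"
  have "ideal C R"
    unfolding C_def using R.colon_ideal[OF R.cgenideal_ideal[OF a(1)] b(1)] .
  moreover have "N \<subseteq> C" "d \<in> C" "C \<subseteq> carrier R"
    using b_mult N.Icarr bd d(1) unfolding C_def by auto
  ultimately have "C = carrier R"
    using N.I_maximal d(2) by blast
  then have "\<one>\<^bsub>R\<^esub> \<in> C"
    by simp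
  with b show False
    unfolding C_def by simp
qed

end

section \<open>Local and global content\<close>

text \<open>The content of \<open>f\<close> over the localization, contracted to \<open>R\<close>.\<close>

lemma ohm_rush_localization_contracted_content:
  assumes R: "domain_localization R W" and S: "domain_localization S (\<phi> ` W)"
    and \<phi>: "\<phi> \<in> ring_hom R S"
    and or: "ohm_rush (localization R W) (localization S (\<phi> ` W)) (loc_map S W \<phi>)"
    and f: "f \<in> carrier S"
  obtains Q where "ideal Q R"
    "\<And>s x. s \<in> W \<Longrightarrow> x \<in> carrier R \<Longrightarrow> s \<otimes>\<^bsub>R\<^esub> x \<in> Q \<Longrightarrow> x \<in> Q"
    "\<exists>s\<in>W. \<phi> s \<otimes>\<^bsub>S\<^esub> f \<in> Idl\<^bsub>S\<^esub> (\<phi> ` Q)"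
    "\<And>I x. ideal I R \<Longrightarrow> f \<in> Idl\<^bsub>S\<^esub> (\<phi> ` I) \<Longrightarrow> x \<in> Q \<Longrightarrow> \<exists>s\<in>W. s \<otimes>\<^bsub>R\<^esub> x \<in> I"
proof -
  interpret R: domain_localization R W by fact
  interpret S: domain_localization S "\<phi> ` W" by fact
  interpret RL: cring R.Loc by (rule R.cring_Loc)
  interpret SL: cring S.Loc by (rule S.cring_Loc)
  define \<psi> where "\<psi> = loc_map S W \<phi>"
  have \<psi>: "\<psi> \<in> ring_hom R.Loc S.Loc"
    unfolding \<psi>_def using R.loc_map_hom[OF S \<phi>] .
  have \<psi>_frac: "\<psi> (R.frac a s) = S.frac (\<phi> a) (\<phi> s)" if "a \<in> carrier R" "s \<in> W" for a s
    unfolding \<psi>_def using R.loc_map_frac[OF S \<phi> that] .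
  note \<phi>_closed = ring_hom_closed[OF \<phi>]
  have \<phi>W: "\<phi> s \<in> \<phi> ` W" "\<phi> s \<in> carrier S" if "s \<in> W" for s
    using that \<phi>_closed by auto
  have fS: "S.frac f \<one>\<^bsub>S\<^esub> \<in> carrier S.Loc"
    using f by simp
  obtain J where J: "ideal J R.Loc" "S.frac f \<one>\<^bsub>S\<^esub> \<in> Idl\<^bsub>S.Loc\<^esub> (\<psi> ` J)"
    "\<And>I. ideal I R.Loc \<Longrightarrow> S.frac f \<one>\<^bsub>S\<^esub> \<in> Idl\<^bsub>S.Loc\<^esub> (\<psi> ` I) \<Longrightarrow> J \<subseteq> I"
    using or[folded \<psi>_def, unfolded ohm_rush_iff[OF R.cring_Loc S.cring_Loc \<psi>]] fS by meson
  interpret J: ideal J R.Loc by fact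
  define Q where "Q = {x \<in> carrier R. R.frac x \<one>\<^bsub>R\<^esub> \<in> J}"
  \<comment> \<open>Multiplying by \<open>s/1\<close> clears the denominator, so numerators of
    elements of \<open>J\<close> lie in \<open>Q\<close>.\<close>
  have Q_frac: "a \<in> Q" if "a \<in> carrier R" "s \<in> W" "R.frac a s \<in> J" for a s
  proof -
    have "R.frac s \<one>\<^bsub>R\<^esub> \<otimes>\<^bsub>R.Loc\<^esub> R.frac a s = R.frac a \<one>\<^bsub>R\<^esub>"
      using that(1,2) by (simp add: R.mult_Loc R.frac_eq_iff R.m_comm)
    then show ?thesis
      unfolding Q_def using J.I_l_closed[OF that(3), of "R.frac s \<one>\<^bsub>R\<^esub>"] that(1,2) by simp
  qed
  have Q: "ideal Q R"
  proof (rule R.idealI_closed)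
    show "\<zero>\<^bsub>R\<^esub> \<in> Q"
      unfolding Q_def using additive_subgroup.zero_closed[OF J.is_additive_subgroup]
      by (simp add: R.frac_zero)
    show "x \<oplus>\<^bsub>R\<^esub> y \<in> Q" if "x \<in> Q" "y \<in> Q" for x y
      using that additive_subgroup.a_closed[OF J.is_additive_subgroup, of "R.frac x \<one>\<^bsub>R\<^esub>" "R.frac y \<one>\<^bsub>R\<^esub>"]
      unfolding Q_def by (simp add: R.add_Loc_same)
    show "r \<otimes>\<^bsub>R\<^esub> x \<in> Q" if "r \<in> carrier R" "x \<in> Q" for r x
      using that J.I_l_closed[of "R.frac x \<one>\<^bsub>R\<^esub>" "R.frac r \<one>\<^bsub>R\<^esub>"]
      unfolding Q_def by (simp add: R.mult_Loc)
  qed (auto simp: Q_def)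
  have QR: "Q \<subseteq> carrier R"
    unfolding Q_def by auto
  show thesis
  proof (rule that[OF Q])
    fix s x assume sx: "s \<in> W" "x \<in> carrier R" "s \<otimes>\<^bsub>R\<^esub> x \<in> Q"
    have "R.frac \<one>\<^bsub>R\<^esub> s \<otimes>\<^bsub>R.Loc\<^esub> R.frac (s \<otimes>\<^bsub>R\<^esub> x) \<one>\<^bsub>R\<^esub> = R.frac x \<one>\<^bsub>R\<^esub>"
      using sx(1,2) by (simp add: R.mult_Loc R.frac_eq_iff R.m_comm)
    then show "x \<in> Q"
      using J.I_l_closed[of "R.frac (s \<otimes>\<^bsub>R\<^esub> x) \<one>\<^bsub>R\<^esub>" "R.frac \<one>\<^bsub>R\<^esub> s"] sx unfolding Q_def by simp
  next
    have QS: "\<phi> ` Q \<subseteq> carrier S"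
      using QR \<phi>_closed by auto
    interpret E: ideal "Idl\<^bsub>S\<^esub> (\<phi> ` Q)" S
      using S.genideal_ideal[OF QS] .
    \<comment> \<open>\<open>H\<close> is the localization of \<open>QS\<close>. It is an ideal
      containing the image of \<open>J\<close>, hence also \<open>f/1\<close>; clearing denominators
      gives a multiple of \<open>f\<close> in \<open>QS\<close>.\<close>
    define H where "H = {S.frac g (\<phi> t) | g t. g \<in> carrier S \<and> t \<in> W \<and>
        (\<exists>s\<in>W. \<phi> s \<otimes>\<^bsub>S\<^esub> g \<in> Idl\<^bsub>S\<^esub> (\<phi> ` Q))}"
    have H_I: "S.frac g (\<phi> t) \<in> H"
      if "g \<in> carrier S" "t \<in> W" "s \<in> W" "\<phi> s \<otimes>\<^bsub>S\<^esub> g \<in> Idl\<^bsub>S\<^esub> (\<phi> ` Q)" for g t s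
      unfolding H_def using that by blast
    have "ideal H S.Loc"
    proof (rule SL.idealI_closed)
      show "H \<subseteq> carrier S.Loc"
        unfolding H_def using \<phi>W by auto
      have "S.frac \<zero>\<^bsub>S\<^esub> (\<phi> \<one>\<^bsub>R\<^esub>) \<in> H"
        by (rule H_I[of _ _ "\<one>\<^bsub>R\<^esub>"])
          (simp_all add: \<phi>_closed additive_subgroup.zero_closed[OF E.is_additive_subgroup])
      then show "\<zero>\<^bsub>S.Loc\<^esub> \<in> H"
        using \<phi>W(1)[OF R.one_W] by (simp add: S.frac_zero)
      show "x \<otimes>\<^bsub>S.Loc\<^esub> y \<in> H" if x: "x \<in> carrier S.Loc" and y: "y \<in> H" for x y
      proof -
        obtain h u where hu: "h \<in> carrier S" "u \<in> W" "x = S.frac h (\<phi> u)"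
          using x unfolding S.carrier_Loc by auto
        obtain g t s where gt: "g \<in> carrier S" "t \<in> W" "s \<in> W" "\<phi> s \<otimes>\<^bsub>S\<^esub> g \<in> Idl\<^bsub>S\<^esub> (\<phi> ` Q)"
          "y = S.frac g (\<phi> t)"
          using y unfolding H_def by auto
        have "x \<otimes>\<^bsub>S.Loc\<^esub> y = S.frac (h \<otimes>\<^bsub>S\<^esub> g) (\<phi> (u \<otimes>\<^bsub>R\<^esub> t))"
          using hu gt by (simp add: S.mult_Loc \<phi>W ring_hom_mult[OF \<phi>])
        moreover have "\<phi> s \<otimes>\<^bsub>S\<^esub> (h \<otimes>\<^bsub>S\<^esub> g) \<in> Idl\<^bsub>S\<^esub> (\<phi> ` Q)"
          using E.I_l_closed[OF gt(4) hu(1)] hu gt(1,3) by (simp add: S.m_lcomm \<phi>_closed)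
        ultimately show ?thesis
          using H_I[of "h \<otimes>\<^bsub>S\<^esub> g" "u \<otimes>\<^bsub>R\<^esub> t" s] hu gt by simp
      qed
      show "x \<oplus>\<^bsub>S.Loc\<^esub> y \<in> H" if x: "x \<in> H" and y: "y \<in> H" for x y
      proof -
        obtain h u v where hu: "h \<in> carrier S" "u \<in> W" "v \<in> W" "\<phi> v \<otimes>\<^bsub>S\<^esub> h \<in> Idl\<^bsub>S\<^esub> (\<phi> ` Q)"
          "x = S.frac h (\<phi> u)"
          using x unfolding H_def by auto
        obtain g t s where gt: "g \<in> carrier S" "t \<in> W" "s \<in> W" "\<phi> s \<otimes>\<^bsub>S\<^esub> g \<in> Idl\<^bsub>S\<^esub> (\<phi> ` Q)"
          "y = S.frac g (\<phi> t)"
          using y unfolding H_def by auto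
        define k where "k = h \<otimes>\<^bsub>S\<^esub> \<phi> t \<oplus>\<^bsub>S\<^esub> g \<otimes>\<^bsub>S\<^esub> \<phi> u"
        have k: "k \<in> carrier S"
          unfolding k_def using hu gt by (simp add: \<phi>_closed)
        have "x \<oplus>\<^bsub>S.Loc\<^esub> y = S.frac k (\<phi> (u \<otimes>\<^bsub>R\<^esub> t))"
          unfolding k_def using hu gt by (simp add: S.add_Loc \<phi>W ring_hom_mult[OF \<phi>])
        moreover have "\<phi> (v \<otimes>\<^bsub>R\<^esub> s) \<otimes>\<^bsub>S\<^esub> k =
          (\<phi> s \<otimes>\<^bsub>S\<^esub> \<phi> t) \<otimes>\<^bsub>S\<^esub> (\<phi> v \<otimes>\<^bsub>S\<^esub> h) \<oplus>\<^bsub>S\<^esub> (\<phi> v \<otimes>\<^bsub>S\<^esub> \<phi> u) \<otimes>\<^bsub>S\<^esub> (\<phi> s \<otimes>\<^bsub>S\<^esub> g)"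
          unfolding k_def using hu(1-3) gt(1-3)
          by (simp add: ring_hom_mult[OF \<phi>] \<phi>_closed S.r_distr S.m_ac)
        moreover have "\<dots> \<in> Idl\<^bsub>S\<^esub> (\<phi> ` Q)"
          using E.I_l_closed[OF hu(4), of "\<phi> s \<otimes>\<^bsub>S\<^esub> \<phi> t"] E.I_l_closed[OF gt(4), of "\<phi> v \<otimes>\<^bsub>S\<^esub> \<phi> u"] hu gt
          by (intro additive_subgroup.a_closed[OF E.is_additive_subgroup]) (simp_all add: \<phi>_closed)
        ultimately show ?thesis
          using H_I[OF k, of "u \<otimes>\<^bsub>R\<^esub> t" "v \<otimes>\<^bsub>R\<^esub> s"] hu gt by simp
      qed
    qed
    moreover have "\<psi> ` J \<subseteq> H"
    proof
      fix z assume "z \<in> \<psi> ` J"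
      then obtain x where x: "x \<in> J" "z = \<psi> x"
        by auto
      then obtain a s where a: "a \<in> carrier R" "s \<in> W" "x = R.frac a s"
        using J.Icarr unfolding R.carrier_Loc by blast
      then have aQ: "a \<in> Q"
        using Q_frac x by auto
      then have "\<phi> \<one>\<^bsub>R\<^esub> \<otimes>\<^bsub>S\<^esub> \<phi> a \<in> Idl\<^bsub>S\<^esub> (\<phi> ` Q)"
        using S.genideal_self[OF QS] a by (auto simp: ring_hom_one[OF \<phi>] \<phi>_closed)
      then show "z \<in> H"
        using H_I[of "\<phi> a" s "\<one>\<^bsub>R\<^esub>"] a x by (simp add: \<psi>_frac \<phi>_closed)
    qed
    ultimately have "S.frac f \<one>\<^bsub>S\<^esub> \<in> H"
      using SL.genideal_minimal[of H "\<psi> ` J"] J(2) by auto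
    then obtain g t s where gt: "S.frac f \<one>\<^bsub>S\<^esub> = S.frac g (\<phi> t)" "g \<in> carrier S" "t \<in> W" "s \<in> W"
      "\<phi> s \<otimes>\<^bsub>S\<^esub> g \<in> Idl\<^bsub>S\<^esub> (\<phi> ` Q)"
      unfolding H_def by auto
    have "f \<otimes>\<^bsub>S\<^esub> \<phi> t = g"
      using gt(1-3) f by (simp add: S.frac_eq_iff \<phi>W)
    then have "\<phi> (s \<otimes>\<^bsub>R\<^esub> t) \<otimes>\<^bsub>S\<^esub> f = \<phi> s \<otimes>\<^bsub>S\<^esub> g"
      using gt(3,4) f by (simp add: ring_hom_mult[OF \<phi>] \<phi>_closed S.m_assoc S.m_comm[of f])
    then show "\<exists>s\<in>W. \<phi> s \<otimes>\<^bsub>S\<^esub> f \<in> Idl\<^bsub>S\<^esub> (\<phi> ` Q)"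
      using gt R.mult_W[of s t] by metis
  next
    fix I x assume I: "ideal I R" and fI: "f \<in> Idl\<^bsub>S\<^esub> (\<phi> ` I)" and x: "x \<in> Q"
    interpret I: ideal I R by fact
    \<comment> \<open>The extension of \<open>I\<close> to the localization of \<open>R\<close>, to
      be compared with \<open>J\<close> by leastness.\<close>
    define E where "E = {R.frac i s | i s. i \<in> I \<and> s \<in> W}"
    have E_I: "R.frac i s \<in> E" if "i \<in> I" "s \<in> W" for i s
      unfolding E_def using that by blast
    have I_zero: "\<zero>\<^bsub>R\<^esub> \<in> I"
      by (rule additive_subgroup.zero_closed[OF I.is_additive_subgroup])
    have E: "ideal E R.Loc"
    proof (rule RL.idealI_closed)
      show "E \<subseteq> carrier R.Loc"
        unfolding E_def using I.Icarr by auto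
      show "\<zero>\<^bsub>R.Loc\<^esub> \<in> E"
        using E_I[OF I_zero R.one_W] by (simp add: R.frac_zero)
      show "y \<otimes>\<^bsub>R.Loc\<^esub> z \<in> E" if y: "y \<in> carrier R.Loc" and z: "z \<in> E" for y z
      proof -
        obtain a s where a: "a \<in> carrier R" "s \<in> W" "y = R.frac a s"
          using y unfolding R.carrier_Loc by auto
        obtain i t where i: "i \<in> I" "t \<in> W" "z = R.frac i t"
          using z unfolding E_def by auto
        show ?thesis
          using a i I.Icarr[OF i(1)] I.I_l_closed[OF i(1) a(1)] by (simp add: R.mult_Loc E_I)
      qed
      show "y \<oplus>\<^bsub>R.Loc\<^esub> z \<in> E" if y: "y \<in> E" and z: "z \<in> E" for y z
      proof -
        obtain j s where j: "j \<in> I" "s \<in> W" "y = R.frac j s"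
          using y unfolding E_def by auto
        obtain i t where i: "i \<in> I" "t \<in> W" "z = R.frac i t"
          using z unfolding E_def by auto
        have "j \<otimes>\<^bsub>R\<^esub> t \<oplus>\<^bsub>R\<^esub> i \<otimes>\<^bsub>R\<^esub> s \<in> I"
          using I.I_r_closed[OF j(1), of t] I.I_r_closed[OF i(1), of s] i(2) j(2)
          by (intro additive_subgroup.a_closed[OF I.is_additive_subgroup]) auto
        then show ?thesis
          using i j I.Icarr by (simp add: R.add_Loc E_I)
      qed
    qed
    have ES: "\<psi> ` E \<subseteq> carrier S.Loc"
      using ideal.Icarr[OF E] ring_hom_closed[OF \<psi>] by auto
    interpret EE: ideal "Idl\<^bsub>S.Loc\<^esub> (\<psi> ` E)" S.Loc
      using SL.genideal_ideal[OF ES] .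
    \<comment> \<open>The contraction to \<open>S\<close> of the ideal that \<open>E\<close>
      generates over the localization. It contains the image of \<open>I\<close>, hence
      \<open>f\<close>, so leastness of \<open>J\<close> gives
      \<open>J \<subseteq> E\<close>.\<close>
    define G where "G = {g \<in> carrier S. S.frac g \<one>\<^bsub>S\<^esub> \<in> Idl\<^bsub>S.Loc\<^esub> (\<psi> ` E)}"
    have "ideal G S"
    proof (rule S.idealI_closed)
      show "\<zero>\<^bsub>S\<^esub> \<in> G"
        unfolding G_def using additive_subgroup.zero_closed[OF EE.is_additive_subgroup]
        by (simp add: S.frac_zero)
      show "y \<oplus>\<^bsub>S\<^esub> z \<in> G" if "y \<in> G" "z \<in> G" for y z
        using that additive_subgroup.a_closed[OF EE.is_additive_subgroup, of "S.frac y \<one>\<^bsub>S\<^esub>" "S.frac z \<one>\<^bsub>S\<^esub>"]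
        unfolding G_def by (simp add: S.add_Loc_same)
      show "r \<otimes>\<^bsub>S\<^esub> z \<in> G" if "r \<in> carrier S" "z \<in> G" for r z
        using that EE.I_l_closed[of "S.frac z \<one>\<^bsub>S\<^esub>" "S.frac r \<one>\<^bsub>S\<^esub>"]
        unfolding G_def by (simp add: S.mult_Loc)
    qed (auto simp: G_def)
    moreover have "\<phi> ` I \<subseteq> G"
    proof
      fix z assume "z \<in> \<phi> ` I"
      then obtain i where i: "i \<in> I" "z = \<phi> i"
        by auto
      have "\<psi> (R.frac i \<one>\<^bsub>R\<^esub>) \<in> Idl\<^bsub>S.Loc\<^esub> (\<psi> ` E)"
        using SL.genideal_self[OF ES] E_I[OF i(1) R.one_W] by auto
      then show "z \<in> G"
        unfolding G_def using i I.Icarr[OF i(1)]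
        by (simp add: \<psi>_frac ring_hom_one[OF \<phi>] \<phi>_closed)
    qed
    ultimately have "f \<in> G"
      using S.genideal_minimal[of G "\<phi> ` I"] fI by auto
    then have "J \<subseteq> E"
      using J(3)[OF E] unfolding G_def by simp
    then have "R.frac x \<one>\<^bsub>R\<^esub> \<in> E"
      using x unfolding Q_def by auto
    then obtain i s where i: "R.frac x \<one>\<^bsub>R\<^esub> = R.frac i s" "i \<in> I" "s \<in> W"
      unfolding E_def by auto
    have "x \<otimes>\<^bsub>R\<^esub> s = i"
      using i x QR I.Icarr[OF i(2)] by (auto simp: R.frac_eq_iff)
    then have "s \<otimes>\<^bsub>R\<^esub> x \<in> I"
      using i x QR by (auto simp: R.m_comm)
    then show "\<exists>s\<in>W. s \<otimes>\<^bsub>R\<^esub> x \<in> I"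
      using i(3) by blast
  qed
qed

lemma (in cyclically_pure_extension) domain_localization_complement:
  assumes M: "maximalideal M R"
  shows "domain_localization R (carrier R - M)" "domain_localization S (\<phi> ` (carrier R - M))"
proof -
  have zero: "\<zero>\<^bsub>R\<^esub> \<in> M"
    using additive_subgroup.zero_closed[OF ideal.axioms(1)[OF maximalideal.axioms(1)[OF M]]] .
  show "domain_localization R (carrier R - M)"
  proof unfold_locales
    show "s \<otimes>\<^bsub>R\<^esub> t \<in> carrier R - M" if "s \<in> carrier R - M" "t \<in> carrier R - M" for s t
      using R.maximal_compl_mult[OF M that] .
  qed (use zero R.maximal_compl_one[OF M] in auto)
  show "domain_localization S (\<phi> ` (carrier R - M))"
  proof unfold_locales
    show "\<phi> ` (carrier R - M) \<subseteq> carrier S"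
      by auto
    show "\<one>\<^bsub>S\<^esub> \<in> \<phi> ` (carrier R - M)"
      using R.maximal_compl_one[OF M] ring_hom_one[OF hom] by force
    show "\<zero>\<^bsub>S\<^esub> \<notin> \<phi> ` (carrier R - M)"
    proof
      assume "\<zero>\<^bsub>S\<^esub> \<in> \<phi> ` (carrier R - M)"
      then obtain r where "r \<in> carrier R" "r \<notin> M" "\<phi> r = \<zero>\<^bsub>S\<^esub>"
        by auto
      then show False
        using hom_eq_zero_iff zero by auto
    qed
    fix x y assume "x \<in> \<phi> ` (carrier R - M)" "y \<in> \<phi> ` (carrier R - M)"
    then obtain s t where st: "s \<in> carrier R - M" "t \<in> carrier R - M" "x = \<phi> s" "y = \<phi> t"
      by auto
    then have "x \<otimes>\<^bsub>S\<^esub> y = \<phi> (s \<otimes>\<^bsub>R\<^esub> t)"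
      by (simp add: hom_mult)
    then show "x \<otimes>\<^bsub>S\<^esub> y \<in> \<phi> ` (carrier R - M)"
      using R.maximal_compl_mult[OF M st(1,2)] by blast
  qed
qed

text \<open>The least ideal is found as the intersection \<open>C\<close> of finitely many
  contracted local contents. Each of the two claims about \<open>C\<close> says that 1 belongs to an
  ideal \<open>D\<close> of multipliers. It suffices that no maximal ideal \<open>N\<close> contains
  \<open>D\<close>, which is shown separately for \<open>N\<close> in \<open>T\<close> and for
  \<open>N\<close> outside \<open>T\<close>.\<close>

lemma (in cyclically_pure_extension) ohm_rush_if_locally:
  assumes dim: "krull_dim R \<le> 1"
    and local: "\<And>M. maximalideal M R \<Longrightarrow>
      ohm_rush (localization R (carrier R - M)) (localization S (\<phi> ` (carrier R - M)))
        (loc_map S (carrier R - M) \<phi>)"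
  shows "ohm_rush R S \<phi>"
  unfolding ohm_rush_iff[OF R.is_cring S.is_cring hom]
proof
  fix f assume f: "f \<in> carrier S"
  show "\<exists>J. ideal J R \<and> f \<in> Idl\<^bsub>S\<^esub> (\<phi> ` J) \<and>
      (\<forall>I. ideal I R \<longrightarrow> f \<in> Idl\<^bsub>S\<^esub> (\<phi> ` I) \<longrightarrow> J \<subseteq> I)"
  \<comment> \<open>Zero lies in the extension of every ideal, so finiteness of \<open>T\<close> is
    available for nonzero \<open>f\<close> only. The content of zero is the zero ideal.\<close>
  proof (cases "f = \<zero>\<^bsub>S\<^esub>")
    case True
    have "{\<zero>\<^bsub>R\<^esub>} \<subseteq> I" if "ideal I R" for I
      using additive_subgroup.zero_closed[OF ideal.axioms(1)[OF that]] by simp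
    moreover have "f \<in> Idl\<^bsub>S\<^esub> (\<phi> ` {\<zero>\<^bsub>R\<^esub>})"
      unfolding extension_zero using True by simp
    ultimately show ?thesis
      using R.zeroideal by blast
  next
    case False
    define T where "T = {M. maximalideal M R \<and> f \<in> Idl\<^bsub>S\<^esub> (\<phi> ` M)}"
    have fin: "finite T"
      unfolding T_def using finite_maximal_ideals_of_element[OF dim f False] .
    have "\<forall>M\<in>T. \<exists>Q. ideal Q R \<and>
        (\<forall>s x. s \<in> carrier R - M \<longrightarrow> x \<in> carrier R \<longrightarrow> s \<otimes>\<^bsub>R\<^esub> x \<in> Q \<longrightarrow> x \<in> Q) \<and>
        (\<exists>s\<in>carrier R - M. \<phi> s \<otimes>\<^bsub>S\<^esub> f \<in> Idl\<^bsub>S\<^esub> (\<phi> ` Q)) \<and>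
        (\<forall>I x. ideal I R \<longrightarrow> f \<in> Idl\<^bsub>S\<^esub> (\<phi> ` I) \<longrightarrow> x \<in> Q \<longrightarrow> (\<exists>s\<in>carrier R - M. s \<otimes>\<^bsub>R\<^esub> x \<in> I))" (is "\<forall>M\<in>T. \<exists>Q. ?P M Q")
    proof
      fix M assume "M \<in> T"
      then have M: "maximalideal M R"
        unfolding T_def by simp
      show "\<exists>Q. ?P M Q"
        by (rule ohm_rush_localization_contracted_content[OF domain_localization_complement[OF M]
            hom local[OF M] f]) blast
    qed
    from bchoice[OF this] obtain Q where Q_all: "\<forall>M\<in>T. ?P M (Q M)" ..
    have Q: "ideal (Q M) R" if "M \<in> T" for M
      using bspec[OF Q_all that] by (elim conjE)
    have contracted: "x \<in> Q M"
      if "M \<in> T" "s \<in> carrier R - M" "x \<in> carrier R" "s \<otimes>\<^bsub>R\<^esub> x \<in> Q M" for M s x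
      using bspec[OF Q_all that(1)] that(2-4) by (elim conjE) blast
    have f_local: "\<exists>s\<in>carrier R - M. \<phi> s \<otimes>\<^bsub>S\<^esub> f \<in> Idl\<^bsub>S\<^esub> (\<phi> ` Q M)" if "M \<in> T" for M
      using bspec[OF Q_all that] by (elim conjE)
    have least: "\<exists>s\<in>carrier R - M. s \<otimes>\<^bsub>R\<^esub> x \<in> I"
      if "M \<in> T" "ideal I R" "f \<in> Idl\<^bsub>S\<^esub> (\<phi> ` I)" "x \<in> Q M" for M I x
      using bspec[OF Q_all that(1)] that(2-4) by (elim conjE) blast
    have maxT: "maximalideal M R" if "M \<in> T" for M
      using that unfolding T_def by simp
    \<comment> \<open>\<open>Q M\<close> is nonzero because its extension contains a nonzero
      multiple of \<open>f\<close>. So for \<open>x\<close> in \<open>M\<close> outside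
      \<open>N\<close> a power of \<open>x\<close> lies in \<open>Q M\<close>, after removing a
      factor outside \<open>M\<close> by \<open>contracted\<close>; that power is not in
      \<open>N\<close>.\<close>
    have not_below: "\<not> Q M \<subseteq> N" if M: "M \<in> T" and N: "maximalideal N R" "N \<noteq> M" for M N
    proof -
      obtain s where s: "s \<in> carrier R - M" "\<phi> s \<otimes>\<^bsub>S\<^esub> f \<in> Idl\<^bsub>S\<^esub> (\<phi> ` Q M)"
        using f_local[OF M] by auto
      have "s \<noteq> \<zero>\<^bsub>R\<^esub>"
        using s(1) additive_subgroup.zero_closed[OF ideal.axioms(1)[OF maximalideal.axioms(1)[OF maxT[OF M]]]]
        by auto
      then have "\<phi> s \<otimes>\<^bsub>S\<^esub> f \<noteq> \<zero>\<^bsub>S\<^esub>"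
        using s(1) f False hom_eq_zero_iff S.integral_iff by simp
      then have "Q M \<noteq> {\<zero>\<^bsub>R\<^esub>}"
        using s(2) extension_zero by (metis singletonD)
      moreover obtain x where x: "x \<in> M" "x \<notin> N"
        using R.maximal_not_subset[OF maxT[OF M] N(1)] N(2) by auto
      moreover have xR: "x \<in> carrier R"
        using x(1) ideal.Icarr[OF maximalideal.axioms(1)[OF maxT[OF M]]] by auto
      ultimately obtain t and k :: nat where "t \<in> carrier R - M" "t \<otimes>\<^bsub>R\<^esub> x [^]\<^bsub>R\<^esub> k \<in> Q M"
        using R.power_in_nonzero_ideal[OF dim maxT[OF M] Q[OF M]] by metis
      then have "x [^]\<^bsub>R\<^esub> k \<in> Q M"
        using contracted[OF M] xR by simp
      moreover have "x [^]\<^bsub>R\<^esub> k \<notin> N"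
        using R.maximal_compl_pow[OF N(1)] x(2) xR by auto
      ultimately show ?thesis
        by auto
    qed
    \<comment> \<open>If \<open>T\<close> is empty, \<open>C\<close> is all of
      \<open>R\<close>.\<close>
    define C where "C = {x \<in> carrier R. \<forall>M\<in>T. x \<in> Q M}"
    have CR: "C \<subseteq> carrier R"
      unfolding C_def by auto
    have C: "ideal C R"
    proof (rule R.idealI_closed[OF CR])
      show "\<zero>\<^bsub>R\<^esub> \<in> C"
        unfolding C_def using additive_subgroup.zero_closed[OF ideal.axioms(1)[OF Q]] by auto
      show "x \<oplus>\<^bsub>R\<^esub> y \<in> C" if "x \<in> C" "y \<in> C" for x y
        using that additive_subgroup.a_closed[OF ideal.axioms(1)[OF Q]] unfolding C_def by auto
      show "r \<otimes>\<^bsub>R\<^esub> x \<in> C" if "r \<in> carrier R" "x \<in> C" for r x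
        using that ideal.I_l_closed[OF Q] unfolding C_def by auto
    qed
    have "C \<subseteq> I" if I: "ideal I R" and fI: "f \<in> Idl\<^bsub>S\<^esub> (\<phi> ` I)" for I
    proof
      fix x assume x: "x \<in> C"
      interpret I: ideal I R by fact
      have xR: "x \<in> carrier R"
        using x CR by auto
      define D where "D = {r \<in> carrier R. x \<otimes>\<^bsub>R\<^esub> r \<in> I}"
      have "D = carrier R"
      proof (rule R.ideal_eq_carrier_if_not_in_maximal)
        show "ideal D R"
          unfolding D_def using R.colon_ideal[OF I xR] .
        fix N assume N: "maximalideal N R"
        interpret N: maximalideal N R by fact
        show "\<not> D \<subseteq> N"
        proof (cases "N \<in> T")
          case True
          then obtain s where s: "s \<in> carrier R - N" "s \<otimes>\<^bsub>R\<^esub> x \<in> I"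
            using least[OF True I fI, of x] x unfolding C_def by auto
          then have "s \<in> D"
            unfolding D_def using xR by (simp add: R.m_comm)
          with s show ?thesis
            by auto
        next
          case False
          have "N \<subseteq> carrier R"
            using N.Icarr by auto
          \<comment> \<open>If \<open>I\<close> were inside \<open>N\<close>, then \<open>f\<close>
            would lie in \<open>NS\<close> and \<open>N\<close> in \<open>T\<close>. The elements of
            \<open>I\<close> themselves multiply \<open>x\<close> into \<open>I\<close>.\<close>
          then have "\<not> I \<subseteq> N"
            using False N extension_mono[of N I] fI unfolding T_def by auto
          moreover have "I \<subseteq> D"
            unfolding D_def using I.I_l_closed xR I.Icarr by auto
          ultimately show ?thesis
            by auto
        qed
      qed
      then show "x \<in> I"
        using xR R.one_closed unfolding D_def by (metis (no_types, lifting) R.r_one mem_Collect_eq)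
    qed
    moreover have "f \<in> Idl\<^bsub>S\<^esub> (\<phi> ` C)"
    proof -
      interpret E: ideal "Idl\<^bsub>S\<^esub> (\<phi> ` C)" S
        using extension_ideal[OF CR] .
      define D where "D = {r \<in> carrier R. \<phi> r \<otimes>\<^bsub>S\<^esub> f \<in> Idl\<^bsub>S\<^esub> (\<phi> ` C)}"
      have "D = carrier R"
      proof (rule R.ideal_eq_carrier_if_not_in_maximal)
        show "ideal D R"
        proof (rule R.idealI_closed)
          show "\<zero>\<^bsub>R\<^esub> \<in> D"
            unfolding D_def using f by (simp add: hom_zero additive_subgroup.zero_closed[OF E.is_additive_subgroup])
          show "x \<oplus>\<^bsub>R\<^esub> y \<in> D" if "x \<in> D" "y \<in> D" for x y
            using that f additive_subgroup.a_closed[OF E.is_additive_subgroup]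
            unfolding D_def by (simp add: ring_hom_add[OF hom] S.l_distr)
          show "r \<otimes>\<^bsub>R\<^esub> x \<in> D" if "r \<in> carrier R" "x \<in> D" for r x
            using that f E.I_l_closed[of "\<phi> x \<otimes>\<^bsub>S\<^esub> f" "\<phi> r"]
            unfolding D_def by (simp add: hom_mult S.m_assoc)
        qed (auto simp: D_def)
        fix N assume N: "maximalideal N R"
        \<comment> \<open>\<open>t\<close> takes care of all members of \<open>T\<close> other than
          \<open>N\<close>, so that only the condition at \<open>N\<close> remains.\<close>
        have "\<exists>t\<in>carrier R - N. \<forall>M\<in>T - {N}. t \<in> Q M"
          using fin Q not_below[OF _ N] by (intro R.avoid_maximal[OF N]) auto
        then obtain t where t: "t \<in> carrier R - N" "\<And>M. M \<in> T - {N} \<Longrightarrow> t \<in> Q M"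
          by auto
        show "\<not> D \<subseteq> N"
        proof (cases "N \<in> T")
          case True
          then obtain s where s: "s \<in> carrier R - N" "\<phi> s \<otimes>\<^bsub>S\<^esub> f \<in> Idl\<^bsub>S\<^esub> (\<phi> ` Q N)"
            using f_local by auto
          have QR: "Q N \<subseteq> carrier R"
            using ideal.Icarr[OF Q[OF True]] by auto
          \<comment> \<open>The products of \<open>t\<close> with elements of \<open>Q N\<close> lie
            in every \<open>Q M\<close>, hence in \<open>C\<close>. Therefore \<open>t\<close>
            carries the extension of \<open>Q N\<close>, which contains \<open>s f\<close>, into
            that of \<open>C\<close>.\<close>
          have "\<phi> t \<otimes>\<^bsub>S\<^esub> (\<phi> s \<otimes>\<^bsub>S\<^esub> f) \<in> Idl\<^bsub>S\<^esub> (\<phi> ` C)"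
          proof (rule S.mult_genideal[OF E.is_ideal _ image_carrier[OF QR] _ s(2)])
            fix z assume "z \<in> \<phi> ` Q N"
            then obtain q where q: "q \<in> Q N" "z = \<phi> q"
              by auto
            have qR: "q \<in> carrier R"
              using q QR by auto
            have "t \<otimes>\<^bsub>R\<^esub> q \<in> Q M" if "M \<in> T" for M
            proof (cases "M = N")
              case True
              then show ?thesis
                using ideal.I_l_closed[OF Q[OF that], of q t] q(1) t(1) by simp
            next
              case False
              then show ?thesis
                using ideal.I_r_closed[OF Q[OF that], of t q] t(2)[of M] that qR by simp
            qed
            then have "t \<otimes>\<^bsub>R\<^esub> q \<in> C"
              unfolding C_def using t(1) qR by simp
            then have "\<phi> (t \<otimes>\<^bsub>R\<^esub> q) \<in> Idl\<^bsub>S\<^esub> (\<phi> ` C)"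
              using extension_mem[OF CR] by blast
            then show "\<phi> t \<otimes>\<^bsub>S\<^esub> z \<in> Idl\<^bsub>S\<^esub> (\<phi> ` C)"
              using t(1) qR q(2) by (simp add: hom_mult)
          qed (use t(1) in simp)
          then have "t \<otimes>\<^bsub>R\<^esub> s \<in> D"
            unfolding D_def using t(1) s(1) f by (simp add: hom_mult S.m_assoc)
          then show ?thesis
            using R.maximal_compl_mult[OF N t(1) s(1)] by auto
        next
          case False
          \<comment> \<open>For \<open>N\<close> outside \<open>T\<close>, removing \<open>N\<close>
            from \<open>T\<close> changes nothing, so \<open>t\<close> itself is in
            \<open>C\<close>.\<close>
          then have "t \<in> C"
            unfolding C_def using t by auto
          then have "\<phi> t \<otimes>\<^bsub>S\<^esub> f \<in> Idl\<^bsub>S\<^esub> (\<phi> ` C)"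
            using E.I_r_closed[OF extension_mem[OF CR] f] by blast
          with t(1) show ?thesis
            unfolding D_def by auto
        qed
      qed
      then have "\<one>\<^bsub>R\<^esub> \<in> D"
        by simp
      then show ?thesis
        unfolding D_def using f by (simp add: ring_hom_one[OF hom])
    qed
    ultimately show ?thesis
      using C by blast
  qed
qed

theorem theorem3p6:
  fixes R :: "('a, 'm) ring_scheme" and S :: "('b, 'n) ring_scheme" and \<phi> :: "'a \<Rightarrow> 'b"
  assumes "domain R" and "krull_dim R = 1"
    and "noetherian_domain S"
    and "\<phi> \<in> ring_hom R S"
    and "faithfully_flat R (module_of_hom S \<phi>)"
    and "\<And>\<mm>. maximalideal \<mm> R \<Longrightarrow>
           ohm_rush (localization R (carrier R - \<mm>)) (localization S (\<phi> ` (carrier R - \<mm>)))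
             (loc_map S (carrier R - \<mm>) \<phi>)"
  shows "ohm_rush R S \<phi>"
proof -
  interpret R: domain R by fact
  interpret S: noetherian_domain S by fact
  interpret cyclically_pure_extension R S \<phi>
  proof unfold_locales
    show "\<phi> \<in> ring_hom R S"
      by fact
    show "r \<in> I" if "ideal I R" "r \<in> carrier R" "\<phi> r \<in> Idl\<^bsub>S\<^esub> (\<phi> ` I)" for I r
      using faithfully_flat_contract_extension[OF R.is_cring S.is_cring assms(4,5) that] .
  qed
  show ?thesis
    using ohm_rush_if_locally assms(2,6) by simp
qed

end
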